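(* Let $d,n\in\mathbb{N}_{\ge1}$ and $0<\alpha<\beta\le1$. Then for all $\varphi_0\in\mathcal{D}^{n,\beta}(\mathbb{R}^d)-\mathrm{Id}$ there exists $\delta>0$ such that for all $\varphi_1,\varphi_2\in B^{n,\beta}(\varphi_0,\delta)\subseteq\mathcal{D}^{n,\beta}(\mathbb{R}^d)-\mathrm{Id}$, $$\|\mathrm{inv}_c(\varphi_1)-\mathrm{inv}_c(\varphi_2)\|_{n,\alpha}\le M\,\|\varphi_1-\varphi_2\|_{n,\alpha}^{\beta-\alpha},$$ where $M=M(n,\varphi_0,\delta)$. In particular, $$\mathrm{inv}_c:(\mathcal{D}^{n,\beta}(\mathbb{R}^d)-\mathrm{Id})\to(\mathcal{D}^{n,\alpha}(\mathbb{R}^d)-\mathrm{Id}),\quad\varphi\mapsto(\mathrm{Id}+\varphi)^{-1}-\mathrm{Id},$$ is continuous.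
   Context: $C^{n,\beta}_0(\mathbb{R}^d,\mathbb{R}^d)$ is the Banach space of $C^n$-maps $f:\mathbb{R}^d\to\mathbb{R}^d$ with $f^{(l)}(x)\to0$ as $\|x\|\to\infty$ for $0\le l\le n$ and $\|f\|_{n,\beta}:=\max\{\sup_{x,\,0\le l\le n}\|f^{(l)}(x)\|,\ \sup_{x\ne y}\|f^{(n)}(x)-f^{(n)}(y)\|/\|x-y\|^\beta\}<\infty$. $\mathcal{D}^{n,\beta}(\mathbb{R}^d):=\{\Phi\in\mathrm{Id}+C^{n,\beta}_0(\mathbb{R}^d,\mathbb{R}^d):\det d\Phi(x)>0\ \forall x\}$; it is a group under composition, and $\mathcal{D}^{n,\beta}(\mathbb{R}^d)-\mathrm{Id}$ is an open subset of $C^{n,\beta}_0(\mathbb{R}^d,\mathbb{R}^d)$. $B^{n,\beta}(\varphi_0,\delta)$ is the open ball in $C^{n,\beta}_0(\mathbb{R}^d,\mathbb{R}^d)$ of radius $\delta$ centered at $\varphi_0$. *)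

theory Defs
  imports "HOL-Analysis.Analysis"
begin

text \<open>\<open>nderiv f x [v\<^sub>1, \<dots>, v\<^sub>l]\<close> is \<open>f\<^sup>(\<^sup>l\<^sup>)(x)(v\<^sub>1, \<dots>, v\<^sub>l)\<close>, where \<open>f\<^sup>(\<^sup>l\<^sup>)(x)\<close>, the Frechet derivative
  at \<open>x\<close> of \<open>f\<^sup>(\<^sup>l\<^sup>-\<^sup>1\<^sup>)\<close>, is viewed as an \<open>l\<close>-linear map acting on lists of length \<open>l\<close>.\<close>

fun nderiv ::
  "('a::real_normed_vector \<Rightarrow> 'b::real_normed_vector) \<Rightarrow> 'a \<Rightarrow> 'a list \<Rightarrow> 'b" where
  "nderiv f x [] = f x"
| "nderiv f x (v # vs) = frechet_derivative (\<lambda>y. nderiv f y vs) (at x) v"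

text \<open>Differentiability and continuity of \<open>f\<^sup>(\<^sup>l\<^sup>)\<close> are stated after evaluation at each list of
  directions; in finite dimension this is the same as for the operator norm.\<close>

definition Cn :: "nat \<Rightarrow> ('a::real_normed_vector \<Rightarrow> 'b::real_normed_vector) \<Rightarrow> bool" where
  "Cn n f \<longleftrightarrow>
     (\<forall>vs. length vs < n \<longrightarrow> (\<lambda>x. nderiv f x vs) differentiable_on UNIV) \<and>
     (\<forall>vs. length vs \<le> n \<longrightarrow> continuous_on UNIV (\<lambda>x. nderiv f x vs))"

definition mlin_norm ::
  "nat \<Rightarrow> ('a::real_normed_vector list \<Rightarrow> 'b::real_normed_vector) \<Rightarrow> real" where
  "mlin_norm l T = Sup {norm (T vs) | vs. length vs = l \<and> (\<forall>v\<in>set vs. norm v \<le> 1)}"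

definition deriv_norms ::
  "nat \<Rightarrow> ('a::real_normed_vector \<Rightarrow> 'b::real_normed_vector) \<Rightarrow> real set" where
  "deriv_norms n f = {mlin_norm l (nderiv f x) | x l. l \<le> n}"

definition holder_quotients ::
  "nat \<Rightarrow> real \<Rightarrow> ('a::real_normed_vector \<Rightarrow> 'b::real_normed_vector) \<Rightarrow> real set" where
  "holder_quotients n \<beta> f =
     {mlin_norm n (\<lambda>vs. nderiv f x vs - nderiv f y vs) / norm (x - y) powr \<beta> | x y. x \<noteq> y}"

text \<open>The suprema below are real-valued, so this is the intended norm only when both sets are
  bounded above; that boundedness (finiteness of the norm) is required in \<open>C0\<close>.\<close>

definition holder_norm ::
  "nat \<Rightarrow> real \<Rightarrow> ('a::real_normed_vector \<Rightarrow> 'b::real_normed_vector) \<Rightarrow> real" where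
  "holder_norm n \<beta> f = max (Sup (deriv_norms n f)) (Sup (holder_quotients n \<beta> f))"

definition C0 ::
  "nat \<Rightarrow> real \<Rightarrow> ('a::real_normed_vector \<Rightarrow> 'b::real_normed_vector) set" where
  "C0 n \<beta> = {f. Cn n f \<and>
     (\<forall>l\<le>n. ((\<lambda>x. mlin_norm l (nderiv f x)) \<longlongrightarrow> 0) at_infinity) \<and>
     bdd_above (deriv_norms n f) \<and> bdd_above (holder_quotients n \<beta> f)}"

definition C0_ball ::
  "nat \<Rightarrow> real \<Rightarrow> ('a::real_normed_vector \<Rightarrow> 'b::real_normed_vector) \<Rightarrow> real \<Rightarrow> ('a \<Rightarrow> 'b) set" where
  "C0_ball n \<beta> \<phi>\<^sub>0 \<delta> = {\<phi> \<in> C0 n \<beta>. holder_norm n \<beta> (\<lambda>x. \<phi> x - \<phi>\<^sub>0 x) < \<delta>}"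

definition Diffeos :: "nat \<Rightarrow> real \<Rightarrow> (real ^ 'd \<Rightarrow> real ^ 'd) set" where
  "Diffeos n \<beta> = {\<Phi>. (\<exists>f \<in> C0 n \<beta>. \<Phi> = (\<lambda>x. x + f x)) \<and>
     (\<forall>x. det (matrix (frechet_derivative \<Phi> (at x))) > 0)}"

definition Diffeos_minus_Id :: "nat \<Rightarrow> real \<Rightarrow> (real ^ 'd \<Rightarrow> real ^ 'd) set" where
  "Diffeos_minus_Id n \<beta> = (\<lambda>\<Phi> x. \<Phi> x - x) ` Diffeos n \<beta>"

definition inv_c :: "('a::real_normed_vector \<Rightarrow> 'a) \<Rightarrow> 'a \<Rightarrow> 'a" where
  "inv_c \<phi> = (\<lambda>y. inv (\<lambda>x. x + \<phi> x) y - y)"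

text \<open>Continuity on \<open>A\<close> for the metrics induced by the norms \<open>N\<^sub>1\<close> (source) and \<open>N\<^sub>2\<close> (target) on
  spaces of functions.\<close>

definition continuous_wrt ::
  "(('a \<Rightarrow> 'b::ab_group_add) \<Rightarrow> real) \<Rightarrow> (('c \<Rightarrow> 'd::ab_group_add) \<Rightarrow> real) \<Rightarrow>
    ('a \<Rightarrow> 'b) set \<Rightarrow> (('a \<Rightarrow> 'b) \<Rightarrow> ('c \<Rightarrow> 'd)) \<Rightarrow> bool" where
  "continuous_wrt N\<^sub>1 N\<^sub>2 A F \<longleftrightarrow>
     (\<forall>f\<in>A. \<forall>e>0. \<exists>d>0. \<forall>g\<in>A.
        N\<^sub>1 (\<lambda>x. g x - f x) < d \<longrightarrow> N\<^sub>2 (\<lambda>x. F g x - F f x) < e)"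

end

theory Submission imports Defs begin

text \<open>
  Write \<open>\<Phi> = Id + \<phi>\<close> and \<open>\<Psi> = \<Phi>\<^sup>-\<^sup>1 = Id + \<psi>\<close>. Near \<open>\<phi>\<^sub>0\<close> the differentials \<open>d\<Phi>\<close> are uniformly bounded
  below, so all \<open>\<Psi>\<close> share a Lipschitz constant \<open>K\<close>, and
  \<open>\<bar>\<Psi>\<^sub>1 - \<Psi>\<^sub>2\<bar> \<le> K sup \<bar>\<phi>\<^sub>1 - \<phi>\<^sub>2\<bar>\<close>. Consider families of functions, indexed by \<open>\<phi>\<close>, all of whose
  derivatives up to some order are uniformly bounded, uniformly \<open>\<beta>\<close>-Hoelder and depend on the index
  with modulus \<open>\<sigma> = \<parallel>\<phi>\<^sub>1 - \<phi>\<^sub>2\<parallel>\<^sup>\<beta>\<close>. Such families are stable under bilinear products, inversion of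
  operators and composition with \<open>\<Psi>\<close>; the identity \<open>d\<Psi> = (d\<Phi> \<circ> \<Psi>)\<^sup>-\<^sup>1\<close> then
  bootstraps the regularity of \<open>\<psi>\<close> up to order \<open>n\<close>. Interpolating the \<open>\<alpha>\<close>-Hoelder seminorm of
  \<open>\<psi>\<^sub>1 - \<psi>\<^sub>2\<close> between its supremum norm, of size \<open>\<sigma>\<close>, and its bounded \<open>\<beta>\<close>-seminorm yields the exponent
  \<open>\<beta> - \<alpha>\<close>.
\<close>


section \<open>Iterated derivatives and Hoelder norms\<close>

text \<open>The loss of exponent comes from composition: the top derivative of \<phi> is only
  \<beta>-Hoelder, so moving its argument from \<open>\<Psi>\<^sub>2\<close> to
  \<open>\<Psi>\<^sub>1\<close> costs the \<beta>-th power of the displacement. The difference of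
  the two maps enters through suprema of derivatives up to order n, which every Hoelder norm of that
  order dominates; hence the weaker \<alpha>-norm may stand on the right. The bootstrap is not
  circular because the chain rule for a composition with \<Psi> at order k consumes the differential
  of \<Psi> only at orders below k, and inversion of operators then returns it at order k. Since
  \<open>inv\<close> is a choice operator, bijectivity of Id + \<phi> has to be established as well:
  a local homeomorphism at bounded distance from the identity is proper, and the set of points with
  several preimages is open, closed and misses far points. The uniform lower bound near
  \<open>\<phi>\<^sub>0\<close> combines compactness with the convergence of the differential to the
  identity at infinity.\<close>

definition blists :: "nat \<Rightarrow> 'a::euclidean_space list set" where
  "blists l = {bs. set bs \<subseteq> Basis \<and> length bs = l}"

definition unit_list :: "'a::real_normed_vector list \<Rightarrow> bool" where
  "unit_list vs \<longleftrightarrow> (\<forall>v\<in>set vs. norm v \<le> 1)"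

text \<open>The coefficient of a tuple of basis vectors when a multilinear map is expanded in all
  its slots. In the expansions both lists have equal length; the value 1 is the empty product that
  ends the recursion.\<close>

fun coord_prod :: "'a::euclidean_space list \<Rightarrow> 'a list \<Rightarrow> real" where
  "coord_prod (v # vs) (b # bs) = (v \<bullet> b) * coord_prod vs bs"
| "coord_prod _ _ = 1"

text \<open>Frechet differentiability is asked in full, but only of iterated partial derivatives,
  finitely many per order. This is what recursively defined families deliver; multilinearity
  recovers arbitrary directions.\<close>

definition basis_differentiable ::
  "nat \<Rightarrow> ('a::euclidean_space \<Rightarrow> 'b::real_normed_vector) \<Rightarrow> bool" where
  "basis_differentiable n f \<longleftrightarrow>
     (\<forall>bs x. set bs \<subseteq> Basis \<longrightarrow> length bs < n \<longrightarrow> (\<lambda>y. nderiv f y bs) differentiable (at x))"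

lemma finite_blists [simp]: "finite (blists l)"
  unfolding blists_def by (rule finite_lists_length_eq) simp

lemma blists_0 [simp]: "blists 0 = {[]}"
  by (auto simp: blists_def)

lemma unit_list_simps [simp]: "unit_list []" "unit_list (v # vs) \<longleftrightarrow> norm v \<le> 1 \<and> unit_list vs"
  by (auto simp: unit_list_def)

lemma unit_list_replicate_0: "unit_list (replicate l 0)"
  by (simp add: unit_list_def)

lemma sum_blists_Suc:
  fixes f :: "'a::euclidean_space list \<Rightarrow> 'b::comm_monoid_add"
  shows "(\<Sum>bs\<in>blists (Suc l). f bs) = (\<Sum>b\<in>Basis. \<Sum>bs\<in>blists l. f (b # bs))"
proof -
  have "(blists (Suc l) :: 'a list set) = (\<lambda>(b, bs). b # bs) ` (Basis \<times> blists l)"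
    by (auto simp: blists_def length_Suc_conv image_iff)
  moreover have "inj_on (\<lambda>(b, bs). b # bs) (Basis \<times> (blists l :: 'a list set))"
    by (auto simp: inj_on_def)
  ultimately have "(\<Sum>bs\<in>blists (Suc l). f bs) = (\<Sum>p\<in>Basis \<times> blists l. f (case p of (b, bs) \<Rightarrow> b # bs))"
    using sum.reindex[of "\<lambda>(b, bs). b # bs" "Basis \<times> blists l" f] by simp
  then show ?thesis
    by (simp add: sum.cartesian_product case_prod_unfold)
qed

lemma abs_coord_prod_le:
  assumes "unit_list vs" "set bs \<subseteq> Basis"
  shows "\<bar>coord_prod vs bs\<bar> \<le> 1"
  using assms
proof (induction vs bs rule: coord_prod.induct)
  case (1 v vs b bs)
  then have "\<bar>v \<bullet> b\<bar> \<le> 1" "\<bar>coord_prod vs bs\<bar> \<le> 1"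
    using Basis_le_norm[of b v] by auto
  then show ?case
    by (simp add: abs_mult mult_le_one)
qed auto

text \<open>By definition \<open>nderiv\<close> is a derivative in its outermost direction alone, so
  linearity in the other slots has to be earned. The expansion for the tail holds at every point and
  may therefore itself be differentiated; the new direction is then expanded by linearity of the
  Frechet derivative.\<close>

lemma nderiv_expand:
  assumes f: "basis_differentiable n f" and "length vs \<le> n"
  shows "nderiv f x vs = (\<Sum>bs\<in>blists (length vs). coord_prod vs bs *\<^sub>R nderiv f x bs)"
  using assms(2)
proof (induction vs arbitrary: x)
  case (Cons v vs)
  have *: "((\<lambda>y. nderiv f y bs) has_derivative frechet_derivative (\<lambda>y. nderiv f y bs) (at x)) (at x)"
    if "bs \<in> blists (length vs)" for bs
    using f Cons.prems that by (auto simp: basis_differentiable_def blists_def frechet_derivative_works)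
  have expand: "frechet_derivative (\<lambda>y. nderiv f y bs) (at x) v = (\<Sum>b\<in>Basis. (v \<bullet> b) *\<^sub>R nderiv f x (b # bs))"
    if "bs \<in> blists (length vs)" for bs
  proof -
    interpret bounded_linear "frechet_derivative (\<lambda>y. nderiv f y bs) (at x)"
      by (rule has_derivative_bounded_linear[OF *[OF that]])
    show ?thesis
      by (subst euclidean_representation[of v, symmetric]) (simp add: sum scaleR)
  qed
  have eq: "(\<lambda>y. nderiv f y vs) = (\<lambda>y. \<Sum>bs\<in>blists (length vs). coord_prod vs bs *\<^sub>R nderiv f y bs)"
    using Cons by (intro ext) simp
  have "((\<lambda>y. \<Sum>bs\<in>blists (length vs). coord_prod vs bs *\<^sub>R nderiv f y bs) has_derivative
      (\<lambda>v. \<Sum>bs\<in>blists (length vs). coord_prod vs bs *\<^sub>R frechet_derivative (\<lambda>y. nderiv f y bs) (at x) v)) (at x)"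
    by (intro has_derivative_sum has_derivative_scaleR_right *)
  then have "nderiv f x (v # vs) =
      (\<Sum>bs\<in>blists (length vs). coord_prod vs bs *\<^sub>R frechet_derivative (\<lambda>y. nderiv f y bs) (at x) v)"
    unfolding nderiv.simps(2) eq by (simp flip: frechet_derivative_at)
  also have "\<dots> = (\<Sum>bs\<in>blists (length vs). coord_prod vs bs *\<^sub>R (\<Sum>b\<in>Basis. (v \<bullet> b) *\<^sub>R nderiv f x (b # bs)))"
    by (intro sum.cong refl) (simp only: expand)
  also have "\<dots> = (\<Sum>b\<in>Basis. \<Sum>bs\<in>blists (length vs). coord_prod (v # vs) (b # bs) *\<^sub>R nderiv f x (b # bs))"
    by (subst sum.swap) (simp add: scaleR_sum_right mult.commute del: nderiv.simps)
  finally show ?case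
    by (simp only: sum_blists_Suc length_Cons)
qed simp

lemma nderiv_differentiable:
  assumes "basis_differentiable n f" and "length vs < n"
  shows "(\<lambda>y. nderiv f y vs) differentiable (at x)"
proof -
  have "(\<lambda>y. nderiv f y vs) = (\<lambda>y. \<Sum>bs\<in>blists (length vs). coord_prod vs bs *\<^sub>R nderiv f y bs)"
    using nderiv_expand[OF assms(1)] assms(2) by (intro ext) auto
  moreover have "\<dots> differentiable (at x)"
    using assms by (intro differentiable_sum differentiable_scaleR differentiable_const finite_blists ballI)
      (auto simp: basis_differentiable_def blists_def)
  ultimately show ?thesis by simp
qed

lemma has_derivative_nderiv:
  assumes "basis_differentiable n f" and "length vs < n"
  shows "((\<lambda>y. nderiv f y vs) has_derivative (\<lambda>v. nderiv f x (v # vs))) (at x)"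
  using nderiv_differentiable[OF assms] by (simp add: frechet_derivative_works)

lemma nderiv_diff:
  assumes f: "basis_differentiable n f" and g: "basis_differentiable n g" and "length vs \<le> n"
  shows "nderiv (\<lambda>x. f x - g x) x vs = nderiv f x vs - nderiv g x vs"
  using assms(3)
proof (induction vs arbitrary: x)
  case (Cons v vs)
  then have eq: "(\<lambda>y. nderiv (\<lambda>x. f x - g x) y vs) = (\<lambda>y. nderiv f y vs - nderiv g y vs)"
    by auto
  have "((\<lambda>y. nderiv f y vs - nderiv g y vs) has_derivative
      (\<lambda>v. nderiv f x (v # vs) - nderiv g x (v # vs))) (at x)"
    using Cons.prems by (intro has_derivative_diff has_derivative_nderiv[OF f] has_derivative_nderiv[OF g]) auto
  from frechet_derivative_at[OF this, symmetric] show ?case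
    unfolding nderiv.simps(2) eq by (rule fun_cong)
qed simp

lemma basis_differentiable_diff:
  assumes f: "basis_differentiable n f" and g: "basis_differentiable n g"
  shows "basis_differentiable n (\<lambda>x. f x - g x)"
  unfolding basis_differentiable_def
proof (intro allI impI)
  fix bs :: "'a list" and x assume *: "set bs \<subseteq> Basis" "length bs < n"
  have "(\<lambda>y. nderiv f y bs - nderiv g y bs) differentiable (at x)"
    using f g * by (intro differentiable_diff) (auto simp: basis_differentiable_def)
  then show "(\<lambda>y. nderiv (\<lambda>x. f x - g x) y bs) differentiable (at x)"
    using * by (simp add: nderiv_diff[OF f g])
qed

lemma norm_nderiv_diff_le_sum:
  assumes f: "basis_differentiable n f" and g: "basis_differentiable n g"
    and "length vs \<le> n" "unit_list vs"
  shows "norm (nderiv f x vs - nderiv g y vs) \<le> (\<Sum>bs\<in>blists (length vs). norm (nderiv f x bs - nderiv g y bs))"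
proof -
  have "nderiv f x vs - nderiv g y vs =
      (\<Sum>bs\<in>blists (length vs). coord_prod vs bs *\<^sub>R (nderiv f x bs - nderiv g y bs))"
    unfolding nderiv_expand[OF f assms(3)] nderiv_expand[OF g assms(3)]
    by (simp add: scaleR_right_diff_distrib sum_subtractf)
  also have "norm \<dots> \<le> (\<Sum>bs\<in>blists (length vs). norm (nderiv f x bs - nderiv g y bs))"
  proof (rule sum_norm_le)
    fix bs :: "'a list" assume "bs \<in> blists (length vs)"
    then have "\<bar>coord_prod vs bs\<bar> \<le> 1"
      using abs_coord_prod_le[OF assms(4)] by (auto simp: blists_def)
    then show "norm (coord_prod vs bs *\<^sub>R (nderiv f x bs - nderiv g y bs)) \<le> norm (nderiv f x bs - nderiv g y bs)"
      by (simp add: mult_left_le_one_le)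
  qed
  finally show ?thesis .
qed

lemma norm_nderiv_le_sum:
  assumes f: "basis_differentiable n f" and "length vs \<le> n" "unit_list vs"
  shows "norm (nderiv f x vs) \<le> (\<Sum>bs\<in>blists (length vs). norm (nderiv f x bs))"
proof -
  have "norm (nderiv f x vs) = norm (\<Sum>bs\<in>blists (length vs). coord_prod vs bs *\<^sub>R nderiv f x bs)"
    unfolding nderiv_expand[OF f assms(2)] ..
  also have "\<dots> \<le> (\<Sum>bs\<in>blists (length vs). norm (nderiv f x bs))"
  proof (rule sum_norm_le)
    fix bs :: "'a list" assume "bs \<in> blists (length vs)"
    then have "\<bar>coord_prod vs bs\<bar> \<le> 1"
      using abs_coord_prod_le[OF assms(3)] by (auto simp: blists_def)
    then show "norm (coord_prod vs bs *\<^sub>R nderiv f x bs) \<le> norm (nderiv f x bs)"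
      by (simp add: mult_left_le_one_le)
  qed
  finally show ?thesis .
qed

lemma Cn_basis_differentiable: "Cn n f \<Longrightarrow> basis_differentiable n f"
  by (auto simp: Cn_def basis_differentiable_def differentiable_on_def)

section \<open>Operator norms of multilinear maps and the Hoelder norm\<close>

lemma mlin_norm_le:
  assumes "\<And>vs. length vs = l \<Longrightarrow> unit_list vs \<Longrightarrow> norm (T vs) \<le> C"
  shows "mlin_norm l T \<le> C"
  unfolding mlin_norm_def
proof (rule cSup_least)
  show "{norm (T vs) |vs. length vs = l \<and> (\<forall>v\<in>set vs. norm v \<le> 1)} \<noteq> {}"
    using unit_list_replicate_0[of l] unfolding unit_list_def by (auto intro: exI[of _ "replicate l 0"])
qed (use assms in \<open>auto simp: unit_list_def\<close>)

text \<open>The a priori bound \<open>C\<close>, however crude, makes the set bounded above, so that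
  the real-valued \<open>Sup\<close> is a genuine supremum.\<close>

lemma norm_le_mlin_norm:
  assumes "\<And>vs. length vs = l \<Longrightarrow> unit_list vs \<Longrightarrow> norm (T vs) \<le> C"
    and "length vs = l" "unit_list vs"
  shows "norm (T vs) \<le> mlin_norm l T"
  unfolding mlin_norm_def
proof (rule cSup_upper)
  show "bdd_above {norm (T vs) |vs. length vs = l \<and> (\<forall>v\<in>set vs. norm v \<le> 1)}"
    by (rule bdd_aboveI[of _ C]) (use assms(1) in \<open>auto simp: unit_list_def\<close>)
qed (use assms in \<open>auto simp: unit_list_def\<close>)

lemma norm_nderiv_le_mlin_norm:
  assumes f: "basis_differentiable n f" and "length vs \<le> n" "unit_list vs"
  shows "norm (nderiv f x vs) \<le> mlin_norm (length vs) (nderiv f x)"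
proof (rule norm_le_mlin_norm)
  show "norm (nderiv f x us) \<le> (\<Sum>bs\<in>blists (length vs). norm (nderiv f x bs))"
    if "length us = length vs" "unit_list us" for us
    using norm_nderiv_le_sum[OF f _ that(2)] that(1) assms(2) by simp
qed (use assms in auto)

lemma norm_nderiv_diff_le_mlin_norm:
  assumes f: "basis_differentiable n f" and "length vs \<le> n" "unit_list vs"
  shows "norm (nderiv f x vs - nderiv f y vs) \<le> mlin_norm (length vs) (\<lambda>vs. nderiv f x vs - nderiv f y vs)"
proof (rule norm_le_mlin_norm[where T = "\<lambda>vs. nderiv f x vs - nderiv f y vs"])
  show "norm (nderiv f x us - nderiv f y us) \<le> (\<Sum>bs\<in>blists (length vs). norm (nderiv f x bs - nderiv f y bs))"
    if "length us = length vs" "unit_list us" for us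
    using norm_nderiv_diff_le_sum[OF f f _ that(2)] that(1) assms(2) by simp
qed (use assms in auto)

lemma C0_basis_differentiable: "f \<in> C0 n \<beta> \<Longrightarrow> basis_differentiable n f"
  by (simp add: C0_def Cn_basis_differentiable)

text \<open>The supremum part of the norm is the same for all Hoelder exponents, so \<gamma> may
  differ from the exponent \<beta> for which membership is known. This lets an \<alpha>-norm control
  derivatives of functions from the \<beta>-space.\<close>

lemma norm_nderiv_le_holder_norm:
  fixes f :: "'a::euclidean_space \<Rightarrow> 'b::real_normed_vector"
  assumes f: "f \<in> C0 n \<beta>" and "length vs \<le> n" "unit_list vs"
  shows "norm (nderiv f x vs) \<le> holder_norm n \<gamma> f"
proof -
  have "norm (nderiv f x vs) \<le> mlin_norm (length vs) (nderiv f x)"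
    by (rule norm_nderiv_le_mlin_norm[OF C0_basis_differentiable[OF f] assms(2,3)])
  also have "\<dots> \<le> Sup (deriv_norms n f)"
    by (rule cSup_upper) (use f assms in \<open>auto simp: C0_def deriv_norms_def\<close>)
  finally show ?thesis
    by (simp add: holder_norm_def)
qed

lemma holder_norm_nonneg:
  assumes "f \<in> C0 n \<beta>"
  shows "0 \<le> holder_norm n \<gamma> (f :: 'a::euclidean_space \<Rightarrow> 'b::real_normed_vector)"
  using norm_nderiv_le_holder_norm[OF assms, of "[]" 0 \<gamma>] norm_ge_zero[of "f 0"] by (simp, linarith)

lemma norm_nderiv_diff_le_holder_norm:
  fixes f :: "'a::euclidean_space \<Rightarrow> 'b::real_normed_vector"
  assumes f: "f \<in> C0 n \<beta>" and "length vs = n" "unit_list vs"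
  shows "norm (nderiv f x vs - nderiv f y vs) \<le> holder_norm n \<beta> f * norm (x - y) powr \<beta>"
proof (cases "x = y")
  case False
  have "norm (nderiv f x vs - nderiv f y vs) / norm (x - y) powr \<beta> \<le>
      mlin_norm n (\<lambda>vs. nderiv f x vs - nderiv f y vs) / norm (x - y) powr \<beta>"
    using norm_nderiv_diff_le_mlin_norm[OF C0_basis_differentiable[OF f] _ assms(3)] assms(2)
    by (intro divide_right_mono) auto
  also have "\<dots> \<le> Sup (holder_quotients n \<beta> f)"
    by (rule cSup_upper) (use f False in \<open>auto simp: C0_def holder_quotients_def\<close>)
  also have "\<dots> \<le> holder_norm n \<beta> f"
    by (simp add: holder_norm_def)
  finally show ?thesis
    using False by (simp add: pos_divide_le_eq)
qed simp

lemma holder_norm_leI: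
  fixes f :: "'a::euclidean_space \<Rightarrow> 'b::real_normed_vector"
  assumes bound: "\<And>x vs. length vs \<le> n \<Longrightarrow> unit_list vs \<Longrightarrow> norm (nderiv f x vs) \<le> C"
    and holder: "\<And>x y vs. length vs = n \<Longrightarrow> unit_list vs \<Longrightarrow>
      norm (nderiv f x vs - nderiv f y vs) \<le> C * norm (x - y) powr \<beta>"
  shows "bdd_above (deriv_norms n f)" "bdd_above (holder_quotients n \<beta> f)" "holder_norm n \<beta> f \<le> C"
proof -
  have D: "t \<le> C" if "t \<in> deriv_norms n f" for t
    using that bound by (auto simp: deriv_norms_def intro!: mlin_norm_le)
  have Q: "t \<le> C" if t: "t \<in> holder_quotients n \<beta> f" for t
  proof -
    obtain x y where xy: "x \<noteq> y" "t = mlin_norm n (\<lambda>vs. nderiv f x vs - nderiv f y vs) / norm (x - y) powr \<beta>"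
      using t unfolding holder_quotients_def by (elim CollectE exE conjE)
    have "mlin_norm n (\<lambda>vs. nderiv f x vs - nderiv f y vs) \<le> C * norm (x - y) powr \<beta>"
      by (rule mlin_norm_le) (rule holder)
    then show ?thesis
      using xy by (simp add: pos_divide_le_eq)
  qed
  show "bdd_above (deriv_norms n f)"
    using D by (rule bdd_aboveI)
  show "bdd_above (holder_quotients n \<beta> f)"
    using Q by (rule bdd_aboveI)
  \<comment> \<open>Estimating a real \<open>Sup\<close> from above requires a nonempty set: a basis
    vector and the origin are two distinct points and provide a quotient.\<close>
  obtain b :: 'a where "b \<in> Basis" using nonempty_Basis by blast
  then have "holder_quotients n \<beta> f \<noteq> {}"
    unfolding holder_quotients_def using nonzero_Basis by blast
  moreover have "deriv_norms n f \<noteq> {}"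
    unfolding deriv_norms_def by blast
  ultimately show "holder_norm n \<beta> f \<le> C"
    using D Q by (auto simp: holder_norm_def intro!: cSup_least)
qed

lemma C0I:
  fixes f :: "'a::euclidean_space \<Rightarrow> 'b::real_normed_vector"
  assumes f: "basis_differentiable n f"
    and cont: "\<And>bs. set bs \<subseteq> Basis \<Longrightarrow> length bs \<le> n \<Longrightarrow> continuous_on UNIV (\<lambda>x. nderiv f x bs)"
    and lim: "\<And>bs. set bs \<subseteq> Basis \<Longrightarrow> length bs \<le> n \<Longrightarrow> ((\<lambda>x. nderiv f x bs) \<longlongrightarrow> 0) at_infinity"
    and bound: "\<And>x bs. set bs \<subseteq> Basis \<Longrightarrow> length bs \<le> n \<Longrightarrow> norm (nderiv f x bs) \<le> C"
    and holder: "\<And>x y bs. set bs \<subseteq> Basis \<Longrightarrow> length bs = n \<Longrightarrow>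
      norm (nderiv f x bs - nderiv f y bs) \<le> C * norm (x - y) powr \<beta>"
  shows "f \<in> C0 n \<beta>"
proof -
  \<comment> \<open>Expanding a list of unit directions costs one term per basis list, so the number
    of basis lists of length up to \<open>n\<close> is a factor that serves every order at
    once.\<close>
  define N where "N = (\<Sum>l\<le>n. real (card (blists l :: 'a list set)))"
  have N: "real (card (blists l :: 'a list set)) \<le> N" if "l \<le> n" for l
    unfolding N_def by (rule member_le_sum) (use that in auto)
  have "C \<ge> 0"
    using order_trans[OF norm_ge_zero bound[of "[]" 0]] by simp
  have "continuous_on UNIV (\<lambda>x. nderiv f x vs)" if "length vs \<le> n" for vs
    unfolding nderiv_expand[OF f that]
    using cont that by (intro continuous_intros) (auto simp: blists_def)
  moreover have "(\<lambda>x. nderiv f x vs) differentiable_on UNIV" if "length vs < n" for vs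
    using nderiv_differentiable[OF f that] by (simp add: differentiable_on_def)
  ultimately have Cn: "Cn n f"
    unfolding Cn_def by blast
  have lim0: "((\<lambda>x. mlin_norm l (nderiv f x)) \<longlongrightarrow> 0) at_infinity" if "l \<le> n" for l
  proof (rule Lim_null_comparison)
    show "((\<lambda>x. \<Sum>bs\<in>blists l. norm (nderiv f x bs)) \<longlongrightarrow> 0) at_infinity"
      using lim that by (intro tendsto_null_sum tendsto_norm_zero) (auto simp: blists_def)
    have "0 \<le> mlin_norm l (nderiv f x)" for x
      using norm_nderiv_le_mlin_norm[OF f _ unit_list_replicate_0[of l], of x] that
      by simp (meson norm_ge_zero order_trans)
    moreover have "mlin_norm l (nderiv f x) \<le> (\<Sum>bs\<in>blists l. norm (nderiv f x bs))" for x
      using norm_nderiv_le_sum[OF f] that by (intro mlin_norm_le) auto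
    ultimately show "\<forall>\<^sub>F x in at_infinity. norm (mlin_norm l (nderiv f x)) \<le> (\<Sum>bs\<in>blists l. norm (nderiv f x bs))"
      by simp
  qed
  have bd: "norm (nderiv f x vs) \<le> N * C" if "length vs \<le> n" "unit_list vs" for x vs
  proof -
    have "norm (nderiv f x vs) \<le> (\<Sum>bs\<in>blists (length vs). norm (nderiv f x bs))"
      by (rule norm_nderiv_le_sum[OF f that])
    also have "\<dots> \<le> real (card (blists (length vs) :: 'a list set)) * C"
      using bound that by (intro sum_bounded_above) (auto simp: blists_def)
    also have "\<dots> \<le> N * C"
      by (intro mult_right_mono N that \<open>C \<ge> 0\<close>)
    finally show ?thesis .
  qed
  have h: "norm (nderiv f x vs - nderiv f y vs) \<le> N * C * norm (x - y) powr \<beta>"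
    if "length vs = n" "unit_list vs" for x y vs
  proof -
    have "norm (nderiv f x vs - nderiv f y vs) \<le> (\<Sum>bs\<in>blists (length vs). norm (nderiv f x bs - nderiv f y bs))"
      using that by (intro norm_nderiv_diff_le_sum[OF f f]) auto
    also have "\<dots> \<le> real (card (blists (length vs) :: 'a list set)) * (C * norm (x - y) powr \<beta>)"
      using holder that by (intro sum_bounded_above) (auto simp: blists_def)
    also have "\<dots> \<le> N * (C * norm (x - y) powr \<beta>)"
      using that \<open>C \<ge> 0\<close> by (intro mult_right_mono N) auto
    finally show ?thesis by (simp add: mult.assoc)
  qed
  moreover have "bdd_above (deriv_norms n f)" "bdd_above (holder_quotients n \<beta> f)"
    by (rule holder_norm_leI[of n f "N * C"]; rule bd h; assumption)+
  ultimately show ?thesis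
    unfolding C0_def using Cn lim0 by blast
qed

lemma C0_tendsto:
  fixes f :: "'a::euclidean_space \<Rightarrow> 'b::real_normed_vector"
  assumes f: "f \<in> C0 n \<beta>" and "length vs \<le> n" "unit_list vs"
  shows "((\<lambda>x. nderiv f x vs) \<longlongrightarrow> 0) at_infinity"
proof (rule Lim_null_comparison)
  show "((\<lambda>x. mlin_norm (length vs) (nderiv f x)) \<longlongrightarrow> 0) at_infinity"
    using f assms(2) by (auto simp: C0_def)
  show "\<forall>\<^sub>F x in at_infinity. norm (nderiv f x vs) \<le> mlin_norm (length vs) (nderiv f x)"
    by (simp add: norm_nderiv_le_mlin_norm[OF C0_basis_differentiable[OF f] assms(2,3)])
qed

lemma C0_continuous:
  assumes "f \<in> C0 n \<beta>" and "length vs \<le> n"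
  shows "continuous_on UNIV (\<lambda>x. nderiv f x vs)"
  using assms by (simp add: C0_def Cn_def)

lemma unit_list_Basis: "set bs \<subseteq> Basis \<Longrightarrow> unit_list bs"
  by (auto simp: unit_list_def)

lemma C0_diff:
  fixes f :: "'a::euclidean_space \<Rightarrow> 'b::real_normed_vector"
  assumes f: "f \<in> C0 n \<beta>" and g: "g \<in> C0 n \<beta>"
  shows "(\<lambda>x. f x - g x) \<in> C0 n \<beta>"
proof -
  note df = C0_basis_differentiable[OF f] and dg = C0_basis_differentiable[OF g]
  note eq = nderiv_diff[OF df dg]
  show ?thesis
  proof (rule C0I[OF basis_differentiable_diff[OF df dg]])
    fix bs :: "'a list" assume bs: "set bs \<subseteq> Basis" "length bs \<le> n"
    show "continuous_on UNIV (\<lambda>x. nderiv (\<lambda>x. f x - g x) x bs)"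
      unfolding eq[OF bs(2)] by (intro continuous_on_diff C0_continuous[OF f] C0_continuous[OF g] bs)
    show "((\<lambda>x. nderiv (\<lambda>x. f x - g x) x bs) \<longlongrightarrow> 0) at_infinity"
      unfolding eq[OF bs(2)]
      using tendsto_diff[OF C0_tendsto[OF f] C0_tendsto[OF g], of bs bs] bs unit_list_Basis by auto
    show "norm (nderiv (\<lambda>x. f x - g x) x bs) \<le> holder_norm n \<beta> f + holder_norm n \<beta> g" for x
      unfolding eq[OF bs(2)]
      by (rule order_trans[OF norm_triangle_ineq4 add_mono])
        (rule norm_nderiv_le_holder_norm[OF f bs(2) unit_list_Basis[OF bs(1)]]
          norm_nderiv_le_holder_norm[OF g bs(2) unit_list_Basis[OF bs(1)]])+
  next
    fix bs :: "'a list" and x y assume bs: "set bs \<subseteq> Basis" "length bs = n"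
    have "nderiv (\<lambda>x. f x - g x) x bs - nderiv (\<lambda>x. f x - g x) y bs =
        (nderiv f x bs - nderiv f y bs) - (nderiv g x bs - nderiv g y bs)"
      using bs by (simp add: eq)
    also have "norm \<dots> \<le> holder_norm n \<beta> f * norm (x - y) powr \<beta> + holder_norm n \<beta> g * norm (x - y) powr \<beta>"
      by (rule order_trans[OF norm_triangle_ineq4 add_mono])
        (rule norm_nderiv_diff_le_holder_norm[OF f bs(2) unit_list_Basis[OF bs(1)]]
          norm_nderiv_diff_le_holder_norm[OF g bs(2) unit_list_Basis[OF bs(1)]])+
    finally show "norm (nderiv (\<lambda>x. f x - g x) x bs - nderiv (\<lambda>x. f x - g x) y bs) \<le>
        (holder_norm n \<beta> f + holder_norm n \<beta> g) * norm (x - y) powr \<beta>"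
      by (simp add: ring_distribs)
  qed
qed

text \<open>With \<theta> = \<alpha>/\<beta>, write \<open>d\<close> as d^\<theta> d^(1-\<theta>)
  and use one bound for each factor. Later \<open>s\<close> is the size of the difference of two
  indices; setting \<open>s = 1\<close> or \<open>t = 1\<close> brings a plain supremum bound into
  the required form.\<close>

lemma powr_interpolate:
  fixes d s t C \<alpha> \<beta> :: real
  assumes "0 \<le> C" "0 \<le> d" "d \<le> C * t powr \<beta>" "d \<le> C * s powr \<beta>" "0 \<le> s" "0 \<le> t" "0 < \<alpha>" "\<alpha> < \<beta>"
  shows "d \<le> C * t powr \<alpha> * s powr (\<beta> - \<alpha>)"
proof (cases "d = 0 \<or> C = 0")
  case False
  then have pos: "d > 0" "C > 0" using assms by auto
  define \<theta> where "\<theta> = \<alpha> / \<beta>"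
  have \<theta>: "0 < \<theta>" "\<theta> < 1" "\<beta> * \<theta> = \<alpha>" "\<beta> * (1 - \<theta>) = \<beta> - \<alpha>"
    using assms pos by (auto simp: \<theta>_def field_simps)
  have "d = d powr \<theta> * d powr (1 - \<theta>)"
    using pos by (simp flip: powr_add)
  also have "\<dots> \<le> (C * t powr \<beta>) powr \<theta> * (C * s powr \<beta>) powr (1 - \<theta>)"
    using assms \<theta> by (intro mult_mono powr_mono2) auto
  also have "\<dots> = (C powr \<theta> * C powr (1 - \<theta>)) * t powr (\<beta> * \<theta>) * s powr (\<beta> * (1 - \<theta>))"
    using pos by (simp add: powr_mult powr_powr)
  also have "C powr \<theta> * C powr (1 - \<theta>) = C"
    using pos by (simp flip: powr_add)
  finally show ?thesis by (simp add: \<theta>)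
qed (use assms in auto)

text \<open>Twice the supremum bounds any difference of values. Interpolating this trivial bound,
  read with \<open>s = 1\<close>, against the \<beta>-quotient lowers the exponent at the price of
  the factor 2.\<close>

lemma C0_holder_le:
  fixes f :: "'a::euclidean_space \<Rightarrow> 'b::real_normed_vector"
  assumes f: "f \<in> C0 n \<beta>" and \<alpha>: "0 < \<alpha>" "\<alpha> < \<beta>" and vs: "length vs = n" "unit_list vs"
  shows "norm (nderiv f x vs - nderiv f y vs) \<le> 2 * holder_norm n \<beta> f * norm (x - y) powr \<alpha>"
proof -
  let ?N = "holder_norm n \<beta> f"
  have "norm (nderiv f x vs - nderiv f y vs) \<le> ?N + ?N"
    by (rule order_trans[OF norm_triangle_ineq4 add_mono]) (rule norm_nderiv_le_holder_norm[OF f _ vs(2)], simp add: vs)+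
  moreover have "norm (nderiv f x vs - nderiv f y vs) \<le> 2 * ?N * norm (x - y) powr \<beta>"
    using norm_nderiv_diff_le_holder_norm[OF f vs, of x y] holder_norm_nonneg[OF f, of \<beta>]
    by (smt (verit) mult_right_mono powr_ge_zero)
  ultimately have "norm (nderiv f x vs - nderiv f y vs) \<le> 2 * ?N * norm (x - y) powr \<alpha> * 1 powr (\<beta> - \<alpha>)"
    using holder_norm_nonneg[OF f, of \<beta>] by (intro powr_interpolate \<alpha>) auto
  then show ?thesis by simp
qed

lemma holder_norm_mono:
  fixes f :: "'a::euclidean_space \<Rightarrow> 'b::real_normed_vector"
  assumes f: "f \<in> C0 n \<beta>" and \<alpha>: "0 < \<alpha>" "\<alpha> < \<beta>"
  shows "holder_norm n \<alpha> f \<le> 2 * holder_norm n \<beta> f"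
proof (rule holder_norm_leI(3))
  show "norm (nderiv f x vs) \<le> 2 * holder_norm n \<beta> f" if "length vs \<le> n" "unit_list vs" for x vs
    using norm_nderiv_le_holder_norm[OF f that, of x \<beta>] norm_ge_zero[of "nderiv f x vs"] by linarith
qed (rule C0_holder_le[OF assms])

lemma C0_mono:
  fixes f :: "'a::euclidean_space \<Rightarrow> 'b::real_normed_vector"
  assumes f: "f \<in> C0 n \<beta>" and \<alpha>: "0 < \<alpha>" "\<alpha> < \<beta>"
  shows "f \<in> C0 n \<alpha>"
proof (rule C0I[OF C0_basis_differentiable[OF f]])
  fix bs :: "'a list" assume bs: "set bs \<subseteq> Basis" "length bs \<le> n"
  show "norm (nderiv f x bs) \<le> 2 * holder_norm n \<beta> f" for x
    using norm_nderiv_le_holder_norm[OF f bs(2) unit_list_Basis[OF bs(1)], of x \<beta>]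
      norm_ge_zero[of "nderiv f x bs"] by linarith
next
  fix bs :: "'a list" and x y assume "set bs \<subseteq> Basis" "length bs = n"
  then show "norm (nderiv f x bs - nderiv f y bs) \<le> 2 * holder_norm n \<beta> f * norm (x - y) powr \<alpha>"
    by (intro C0_holder_le[OF assms] unit_list_Basis)
qed (auto intro: C0_continuous[OF f] C0_tendsto[OF f] unit_list_Basis)

lemma holder_norm_0: "holder_norm n \<beta> (\<lambda>x::'a::euclidean_space. 0::'b::real_normed_vector) \<le> 0"
proof -
  have "nderiv (\<lambda>x::'a. 0::'b) x vs = 0" for x vs
  proof (induction vs arbitrary: x)
    case (Cons v vs)
    then have "(\<lambda>y. nderiv (\<lambda>x::'a. 0::'b) y vs) = (\<lambda>y. 0)" by auto
    then show ?case by simp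
  qed simp
  then show ?thesis by (intro holder_norm_leI(3)) auto
qed

section \<open>Families with uniform Hoelder bounds\<close>

text \<open>The modulus \<open>\<sigma>\<close> measures the dependence on the index. The order is counted through partial
  derivatives \<open>G b\<close>, so that the codomain stays the same along the recursion. Functions need only have
  a limit at infinity, which keeps products and inverses inside the class, while derivatives must
  vanish there.\<close>

definition holder_family0 ::
  "'i set \<Rightarrow> real \<Rightarrow> ('i \<Rightarrow> 'i \<Rightarrow> real) \<Rightarrow>
    ('i \<Rightarrow> 'a::real_normed_vector \<Rightarrow> 'b::real_normed_vector) \<Rightarrow> bool" where
  "holder_family0 I \<beta> \<sigma> F \<longleftrightarrow>
     (\<exists>C. (\<forall>i\<in>I. \<forall>x. norm (F i x) \<le> C) \<and>
          (\<forall>i\<in>I. \<forall>x y. norm (F i x - F i y) \<le> C * norm (x - y) powr \<beta>) \<and>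
          (\<forall>i\<in>I. \<forall>j\<in>I. \<forall>x. norm (F i x - F j x) \<le> C * \<sigma> i j)) \<and>
     (\<forall>i\<in>I. \<exists>L. (F i \<longlongrightarrow> L) at_infinity)"

primrec holder_family ::
  "'i set \<Rightarrow> real \<Rightarrow> ('i \<Rightarrow> 'i \<Rightarrow> real) \<Rightarrow> nat \<Rightarrow>
    ('i \<Rightarrow> 'a::euclidean_space \<Rightarrow> 'b::real_normed_vector) \<Rightarrow> bool" where
  "holder_family I \<beta> \<sigma> 0 F \<longleftrightarrow> holder_family0 I \<beta> \<sigma> F"
| "holder_family I \<beta> \<sigma> (Suc k) F \<longleftrightarrow> holder_family0 I \<beta> \<sigma> F \<and>
     (\<exists>G. (\<forall>i\<in>I. \<forall>x. (F i has_derivative (\<lambda>v. \<Sum>b\<in>Basis. (v \<bullet> b) *\<^sub>R G b i x)) (at x)) \<and>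
          (\<forall>b\<in>Basis. (\<forall>i\<in>I. (G b i \<longlongrightarrow> 0) at_infinity) \<and> holder_family I \<beta> \<sigma> k (G b)))"

lemma holder_family_imp_holder_family0: "holder_family I \<beta> \<sigma> k F \<Longrightarrow> holder_family0 I \<beta> \<sigma> F"
  by (cases k) auto

lemma holder_family_SucE:
  assumes "holder_family I \<beta> \<sigma> (Suc k) F"
  obtains G where
    "\<And>i x. i \<in> I \<Longrightarrow> (F i has_derivative (\<lambda>v. \<Sum>b\<in>Basis. (v \<bullet> b) *\<^sub>R G b i x)) (at x)"
    "\<And>b i. b \<in> Basis \<Longrightarrow> i \<in> I \<Longrightarrow> (G b i \<longlongrightarrow> 0) at_infinity"
    "\<And>b. b \<in> Basis \<Longrightarrow> holder_family I \<beta> \<sigma> k (G b)"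
  using assms unfolding holder_family.simps(2) by blast

lemma holder_family_SucI:
  assumes "holder_family0 I \<beta> \<sigma> F"
    and "\<And>i x. i \<in> I \<Longrightarrow> (F i has_derivative (\<lambda>v. \<Sum>b\<in>Basis. (v \<bullet> b) *\<^sub>R G b i x)) (at x)"
    and "\<And>b i. b \<in> Basis \<Longrightarrow> i \<in> I \<Longrightarrow> (G b i \<longlongrightarrow> 0) at_infinity"
    and "\<And>b. b \<in> Basis \<Longrightarrow> holder_family I \<beta> \<sigma> k (G b)"
  shows "holder_family I \<beta> \<sigma> (Suc k) F"
  using assms unfolding holder_family.simps(2) by blast

lemma holder_family_limit:
  assumes "holder_family I \<beta> \<sigma> k F" "i \<in> I"
  obtains L where "(F i \<longlongrightarrow> L) at_infinity"
  using holder_family_imp_holder_family0[OF assms(1)] assms(2) unfolding holder_family0_def by blast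

lemma holder_family0_limit:
  assumes "holder_family0 I \<beta> \<sigma> F" "i \<in> I"
  obtains L where "(F i \<longlongrightarrow> L) at_infinity"
  using assms unfolding holder_family0_def by blast

lemma holder_family_pred: "holder_family I \<beta> \<sigma> (Suc k) F \<Longrightarrow> holder_family I \<beta> \<sigma> k F"
proof (induction k arbitrary: F)
  case (Suc k)
  show ?case
    using Suc.prems Suc.IH unfolding holder_family.simps(2)[of _ _ _ "Suc k"] holder_family.simps(2)[of _ _ _ k F]
    by blast
qed auto

lemma holder_family_mono: "holder_family I \<beta> \<sigma> k F \<Longrightarrow> j \<le> k \<Longrightarrow> holder_family I \<beta> \<sigma> j F"
proof (induction k)
  case (Suc k)
  then show ?case
    using holder_family_pred le_Suc_eq by blast
qed auto

lemma holder_family0_cong: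
  assumes "holder_family0 I \<beta> \<sigma> F" "\<And>i. i \<in> I \<Longrightarrow> F i = H i"
  shows "holder_family0 I \<beta> \<sigma> H"
  using assms unfolding holder_family0_def by (metis (no_types, lifting))

text \<open>Functions matter only at indices in \<open>I\<close>, so a family may be rewritten by an
  identity that holds only there, such as a formula for the inverse that relies on
  bijectivity.\<close>

lemma holder_family_cong:
  assumes "holder_family I \<beta> \<sigma> k F" "\<And>i. i \<in> I \<Longrightarrow> F i = H i"
  shows "holder_family I \<beta> \<sigma> k H"
proof (cases k)
  case 0
  then show ?thesis using assms holder_family0_cong[of I \<beta> \<sigma> F H] by simp
next
  case (Suc m)
  obtain G where G: "\<And>i x. i \<in> I \<Longrightarrow> (F i has_derivative (\<lambda>v. \<Sum>b\<in>Basis. (v \<bullet> b) *\<^sub>R G b i x)) (at x)"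
    "\<And>b i. b \<in> Basis \<Longrightarrow> i \<in> I \<Longrightarrow> (G b i \<longlongrightarrow> 0) at_infinity"
    "\<And>b. b \<in> Basis \<Longrightarrow> holder_family I \<beta> \<sigma> m (G b)"
    using holder_family_SucE[OF assms(1)[unfolded Suc]] by blast
  have "holder_family0 I \<beta> \<sigma> H"
    by (rule holder_family0_cong[OF holder_family_imp_holder_family0[OF assms(1)] assms(2)])
  moreover have "(H i has_derivative (\<lambda>v. \<Sum>b\<in>Basis. (v \<bullet> b) *\<^sub>R G b i x)) (at x)" if "i \<in> I" for i x
    using G(1)[OF that, of x] assms(2)[OF that] by simp
  ultimately show ?thesis
    unfolding Suc using G(2,3) by (rule holder_family_SucI)
qed

lemma holder_family0I:
  assumes "\<And>i x. i \<in> I \<Longrightarrow> norm (F i x) \<le> C1"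
    and "\<And>i x y. i \<in> I \<Longrightarrow> norm (F i x - F i y) \<le> C2 * norm (x - y) powr \<beta>"
    and "\<And>i j x. i \<in> I \<Longrightarrow> j \<in> I \<Longrightarrow> norm (F i x - F j x) \<le> C3 * \<sigma> i j"
    and "\<And>i j. i \<in> I \<Longrightarrow> j \<in> I \<Longrightarrow> 0 \<le> \<sigma> i j"
    and "\<And>i. i \<in> I \<Longrightarrow> \<exists>L. (F i \<longlongrightarrow> L) at_infinity"
  shows "holder_family0 I \<beta> \<sigma> F"
proof -
  define C where "C = max C1 (max C2 C3)"
  have "norm (F i x) \<le> C" if "i \<in> I" for i x
    using assms(1)[OF that, of x] unfolding C_def by linarith
  moreover have "norm (F i x - F i y) \<le> C * norm (x - y) powr \<beta>" if "i \<in> I" for i x y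
    by (rule order_trans[OF assms(2)[OF that] mult_right_mono]) (auto simp: C_def)
  moreover have "norm (F i x - F j x) \<le> C * \<sigma> i j" if "i \<in> I" "j \<in> I" for i j x
    by (rule order_trans[OF assms(3)[OF that] mult_right_mono]) (auto simp: C_def assms(4) that)
  ultimately show ?thesis
    unfolding holder_family0_def using assms(5) by blast
qed

text \<open>The definition leaves the sign of \<open>\<sigma>\<close> open. With
  \<open>max 0\<close> in place of \<open>\<sigma>\<close> and a positive \<open>C\<close>, the
  right-hand sides can be scaled and multiplied freely.\<close>

lemma holder_family0E:
  assumes "holder_family0 I \<beta> \<sigma> F"
  obtains C where "C > 0"
    "\<And>i x. i \<in> I \<Longrightarrow> norm (F i x) \<le> C"
    "\<And>i x y. i \<in> I \<Longrightarrow> norm (F i x - F i y) \<le> C * norm (x - y) powr \<beta>"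
    "\<And>i j x. i \<in> I \<Longrightarrow> j \<in> I \<Longrightarrow> norm (F i x - F j x) \<le> C * max 0 (\<sigma> i j)"
proof -
  obtain C where C: "\<forall>i\<in>I. \<forall>x. norm (F i x) \<le> C"
    "\<forall>i\<in>I. \<forall>x y. norm (F i x - F i y) \<le> C * norm (x - y) powr \<beta>"
    "\<forall>i\<in>I. \<forall>j\<in>I. \<forall>x. norm (F i x - F j x) \<le> C * \<sigma> i j"
    using assms unfolding holder_family0_def by blast
  show ?thesis
  proof (rule that[of "max C 1"])
    show "norm (F i x) \<le> max C 1" if "i \<in> I" for i x
      using C(1) that by (meson max.coboundedI1)
    show "norm (F i x - F i y) \<le> max C 1 * norm (x - y) powr \<beta>" if "i \<in> I" for i x y
      by (rule order_trans[OF C(2)[rule_format, OF that] mult_right_mono]) auto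
    show "norm (F i x - F j x) \<le> max C 1 * max 0 (\<sigma> i j)" if ij: "i \<in> I" "j \<in> I" for i j x
    proof -
      have "norm (F i x) \<le> C" using C(1) ij by blast
      then have "0 \<le> C" using norm_ge_zero order_trans by blast
      then have "C * \<sigma> i j \<le> max C 1 * max 0 (\<sigma> i j)"
        by (meson max.cobounded1 max.cobounded2 mult_left_mono mult_right_mono order_trans)
      then show ?thesis
        using C(3) ij by (meson order_trans)
    qed
  qed auto
qed

section \<open>Closure of families under linear maps, sums, products and composition\<close>

context
  fixes I :: "'i set" and \<beta> :: real and \<sigma> :: "'i \<Rightarrow> 'i \<Rightarrow> real"
  assumes \<sigma>_nonneg: "\<And>i j. i \<in> I \<Longrightarrow> j \<in> I \<Longrightarrow> 0 \<le> \<sigma> i j"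
begin

lemma holder_family0_const: "holder_family0 I \<beta> \<sigma> (\<lambda>i x. c)"
  by (rule holder_family0I[of I _ "norm c" 0 _ 0]) (auto simp: \<sigma>_nonneg)

lemma holder_family_const: "holder_family I \<beta> \<sigma> k (\<lambda>i x. c)"
proof (induction k arbitrary: c)
  case (Suc k)
  show ?case
    by (auto simp: holder_family0_const intro!: exI[of _ "\<lambda>b i x. 0"] Suc)
qed (simp add: holder_family0_const)

lemma holder_family0_linear:
  assumes T: "bounded_linear T" and F: "holder_family0 I \<beta> \<sigma> F"
  shows "holder_family0 I \<beta> \<sigma> (\<lambda>i x. T (F i x))"
proof -
  interpret T: bounded_linear T by fact
  obtain K where K: "K > 0" "\<And>x. norm (T x) \<le> norm x * K" using T.pos_bounded by blast
  obtain C where C: "C > 0"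
    "\<And>i x. i \<in> I \<Longrightarrow> norm (F i x) \<le> C"
    "\<And>i x y. i \<in> I \<Longrightarrow> norm (F i x - F i y) \<le> C * norm (x - y) powr \<beta>"
    "\<And>i j x. i \<in> I \<Longrightarrow> j \<in> I \<Longrightarrow> norm (F i x - F j x) \<le> C * max 0 (\<sigma> i j)"
    using holder_family0E[OF F] by metis
  have *: "norm (T x) \<le> K * D" if "norm x \<le> D" for x D
    by (metis K mult.commute mult_le_cancel_right_pos order_trans that)
  show ?thesis
  proof (rule holder_family0I[of I _ "K * C" "K * C" _ "K * C"])
    show "norm (T (F i x)) \<le> K * C" if "i \<in> I" for i x
      using * C(2) that by blast
    show "norm (T (F i x) - T (F i y)) \<le> K * C * norm (x - y) powr \<beta>" if "i \<in> I" for i x y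
      using *[OF C(3)[OF that]] by (simp add: T.diff mult.assoc)
    show "norm (T (F i x) - T (F j x)) \<le> K * C * \<sigma> i j" if "i \<in> I" "j \<in> I" for i j x
      using *[OF C(4)[OF that]] \<sigma>_nonneg[OF that] by (simp add: T.diff mult.assoc)
    show "\<exists>L. ((\<lambda>x. T (F i x)) \<longlongrightarrow> L) at_infinity" if "i \<in> I" for i
      using holder_family0_limit[OF F that] T.tendsto by metis
  qed (rule \<sigma>_nonneg)
qed

lemma holder_family_linear:
  assumes T: "bounded_linear T" and F: "holder_family I \<beta> \<sigma> k F"
  shows "holder_family I \<beta> \<sigma> k (\<lambda>i x. T (F i x))"
  using F
proof (induction k arbitrary: F)
  case 0
  then show ?case using holder_family0_linear[OF T] by simp
next
  case (Suc k)
  interpret T: bounded_linear T by fact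
  obtain G where G: "\<And>i x. i \<in> I \<Longrightarrow> (F i has_derivative (\<lambda>v. \<Sum>b\<in>Basis. (v \<bullet> b) *\<^sub>R G b i x)) (at x)"
    "\<And>b i. b \<in> Basis \<Longrightarrow> i \<in> I \<Longrightarrow> (G b i \<longlongrightarrow> 0) at_infinity"
    "\<And>b. b \<in> Basis \<Longrightarrow> holder_family I \<beta> \<sigma> k (G b)"
    using holder_family_SucE[OF Suc.prems] by blast
  have "((\<lambda>x. T (F i x)) has_derivative (\<lambda>v. \<Sum>b\<in>Basis. (v \<bullet> b) *\<^sub>R T (G b i x))) (at x)"
    if "i \<in> I" for i x
    using T.has_derivative[OF G(1)[OF that]] by (simp add: T.sum T.scaleR)
  moreover have "((\<lambda>x. T (G b i x)) \<longlongrightarrow> 0) at_infinity" if "b \<in> Basis" "i \<in> I" for b i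
    using T.tendsto[OF G(2)[OF that]] by (simp add: T.zero)
  ultimately show ?case
    using holder_family0_linear[OF T, of F] Suc.IH[OF G(3)] Suc.prems[THEN holder_family_imp_holder_family0]
    by (intro holder_family_SucI[where G = "\<lambda>b i x. T (G b i x)"]) auto
qed

lemma holder_family0_add:
  assumes F: "holder_family0 I \<beta> \<sigma> F" and H: "holder_family0 I \<beta> \<sigma> H"
  shows "holder_family0 I \<beta> \<sigma> (\<lambda>i x. F i x + H i x)"
proof -
  obtain C where C: 
    "\<And>i x. i \<in> I \<Longrightarrow> norm (F i x) \<le> C"
    "\<And>i x y. i \<in> I \<Longrightarrow> norm (F i x - F i y) \<le> C * norm (x - y) powr \<beta>"
    "\<And>i j x. i \<in> I \<Longrightarrow> j \<in> I \<Longrightarrow> norm (F i x - F j x) \<le> C * max 0 (\<sigma> i j)"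
    using holder_family0E[OF F] by metis
  obtain D where D: 
    "\<And>i x. i \<in> I \<Longrightarrow> norm (H i x) \<le> D"
    "\<And>i x y. i \<in> I \<Longrightarrow> norm (H i x - H i y) \<le> D * norm (x - y) powr \<beta>"
    "\<And>i j x. i \<in> I \<Longrightarrow> j \<in> I \<Longrightarrow> norm (H i x - H j x) \<le> D * max 0 (\<sigma> i j)"
    using holder_family0E[OF H] by metis
  show ?thesis
  proof (rule holder_family0I[of I _ "C + D" "C + D" _ "C + D"])
    show "norm (F i x + H i x) \<le> C + D" if "i \<in> I" for i x
      using C(1) D(1) that by (meson add_mono norm_triangle_le)
    show "norm (F i x + H i x - (F i y + H i y)) \<le> (C + D) * norm (x - y) powr \<beta>" if "i \<in> I" for i x y
      using norm_diff_triangle_ineq[of "F i x" "H i x" "F i y" "H i y"] C(2)[OF that, of x y] D(2)[OF that, of x y]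
      by (simp add: ring_distribs)
    show "norm (F i x + H i x - (F j x + H j x)) \<le> (C + D) * \<sigma> i j" if "i \<in> I" "j \<in> I" for i j x
      using norm_diff_triangle_ineq[of "F i x" "H i x" "F j x" "H j x"] C(3)[OF that, of x] D(3)[OF that, of x]
        \<sigma>_nonneg[OF that]
      by (simp add: ring_distribs)
    show "\<exists>L. ((\<lambda>x. F i x + H i x) \<longlongrightarrow> L) at_infinity" if "i \<in> I" for i
      using holder_family0_limit[OF F that] holder_family0_limit[OF H that] tendsto_add by metis
  qed (rule \<sigma>_nonneg)
qed

lemma holder_family_add:
  assumes "holder_family I \<beta> \<sigma> k F" "holder_family I \<beta> \<sigma> k H"
  shows "holder_family I \<beta> \<sigma> k (\<lambda>i x. F i x + H i x)"
  using assms
proof (induction k arbitrary: F H)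
  case 0
  then show ?case using holder_family0_add by simp
next
  case (Suc k)
  obtain G where G: "\<And>i x. i \<in> I \<Longrightarrow> (F i has_derivative (\<lambda>v. \<Sum>b\<in>Basis. (v \<bullet> b) *\<^sub>R G b i x)) (at x)"
    "\<And>b i. b \<in> Basis \<Longrightarrow> i \<in> I \<Longrightarrow> (G b i \<longlongrightarrow> 0) at_infinity"
    "\<And>b. b \<in> Basis \<Longrightarrow> holder_family I \<beta> \<sigma> k (G b)"
    using holder_family_SucE[OF Suc.prems(1)] by blast
  obtain J where J: "\<And>i x. i \<in> I \<Longrightarrow> (H i has_derivative (\<lambda>v. \<Sum>b\<in>Basis. (v \<bullet> b) *\<^sub>R J b i x)) (at x)"
    "\<And>b i. b \<in> Basis \<Longrightarrow> i \<in> I \<Longrightarrow> (J b i \<longlongrightarrow> 0) at_infinity"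
    "\<And>b. b \<in> Basis \<Longrightarrow> holder_family I \<beta> \<sigma> k (J b)"
    using holder_family_SucE[OF Suc.prems(2)] by blast
  have "((\<lambda>x. F i x + H i x) has_derivative (\<lambda>v. \<Sum>b\<in>Basis. (v \<bullet> b) *\<^sub>R (G b i x + J b i x))) (at x)"
    if "i \<in> I" for i x
    using has_derivative_add[OF G(1)[OF that] J(1)[OF that], of x]
    by (simp add: scaleR_right_distrib sum.distrib)
  moreover have "((\<lambda>x. G b i x + J b i x) \<longlongrightarrow> 0) at_infinity" if "b \<in> Basis" "i \<in> I" for b i
    using tendsto_add[OF G(2)[OF that] J(2)[OF that]] by simp
  ultimately show ?case
    using holder_family0_add[of F H] Suc.IH[OF G(3) J(3)] Suc.prems[THEN holder_family_imp_holder_family0]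
    by (intro holder_family_SucI[where G = "\<lambda>b i x. G b i x + J b i x"]) auto
qed

lemma holder_family_sum:
  assumes "\<And>s. s \<in> S \<Longrightarrow> holder_family I \<beta> \<sigma> k (F s)"
  shows "holder_family I \<beta> \<sigma> k (\<lambda>i x. \<Sum>s\<in>S. F s i x)"
  using assms
  by (induction S rule: infinite_finite_induct) (auto intro: holder_family_const holder_family_add)

lemma holder_family0_bilinear:
  assumes pr: "bounded_bilinear pr" and F: "holder_family0 I \<beta> \<sigma> F" and H: "holder_family0 I \<beta> \<sigma> H"
  shows "holder_family0 I \<beta> \<sigma> (\<lambda>i x. pr (F i x) (H i x))"
proof -
  interpret bounded_bilinear pr by fact
  obtain K where K: "K > 0" "\<And>x y. norm (pr x y) \<le> norm x * norm y * K" using pos_bounded by blast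
  obtain C where C: "C > 0"
    "\<And>i x. i \<in> I \<Longrightarrow> norm (F i x) \<le> C"
    "\<And>i x y. i \<in> I \<Longrightarrow> norm (F i x - F i y) \<le> C * norm (x - y) powr \<beta>"
    "\<And>i j x. i \<in> I \<Longrightarrow> j \<in> I \<Longrightarrow> norm (F i x - F j x) \<le> C * max 0 (\<sigma> i j)"
    using holder_family0E[OF F] by metis
  obtain D where D: "D > 0"
    "\<And>i x. i \<in> I \<Longrightarrow> norm (H i x) \<le> D"
    "\<And>i x y. i \<in> I \<Longrightarrow> norm (H i x - H i y) \<le> D * norm (x - y) powr \<beta>"
    "\<And>i j x. i \<in> I \<Longrightarrow> j \<in> I \<Longrightarrow> norm (H i x - H j x) \<le> D * max 0 (\<sigma> i j)"
    using holder_family0E[OF H] by metis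
  have prod_le: "norm (pr x y) \<le> c * d * K" if "norm x \<le> c" "norm y \<le> d" for x y c d
  proof -
    have "norm x * norm y \<le> c * d"
      by (rule mult_mono[OF that]) (use that order_trans[OF norm_ge_zero] in auto)
    then show ?thesis
      using K by (meson less_imp_le mult_right_mono order_trans)
  qed
  \<comment> \<open>One telescoping estimate covers both conditions: \<open>t\<close> is |x -
    y|^\<beta> for the Hoelder bound and \<open>\<sigma> i j\<close> for the dependence on the
    index.\<close>
  have diff_le: "norm (pr a b - pr a' b') \<le> 2 * C * D * K * t"
    if "norm a' \<le> C" "norm b \<le> D" "norm (a - a') \<le> C * t" "norm (b - b') \<le> D * t" for a a' b b' t
  proof -
    have "pr a b - pr a' b' = pr (a - a') b + pr a' (b - b')"
      by (simp add: diff_left diff_right)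
    then have "norm (pr a b - pr a' b') \<le> norm (pr (a - a') b) + norm (pr a' (b - b'))"
      by (metis norm_triangle_ineq)
    also have "\<dots> \<le> C * t * D * K + C * (D * t) * K"
      by (intro add_mono prod_le that)
    finally show ?thesis
      by (simp add: algebra_simps)
  qed
  show ?thesis
  proof (rule holder_family0I[of I _ "C * D * K" "2 * C * D * K" _ "2 * C * D * K"])
    show "norm (pr (F i x) (H i x)) \<le> C * D * K" if "i \<in> I" for i x
      by (intro prod_le C D that)
    show "norm (pr (F i x) (H i x) - pr (F i y) (H i y)) \<le> 2 * C * D * K * norm (x - y) powr \<beta>"
      if "i \<in> I" for i x y
      by (intro diff_le C D that)
    show "norm (pr (F i x) (H i x) - pr (F j x) (H j x)) \<le> 2 * C * D * K * \<sigma> i j"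
      if "i \<in> I" "j \<in> I" for i j x
      using C(4)[OF that, of x] D(4)[OF that, of x] \<sigma>_nonneg[OF that]
      by (intro diff_le C D that) auto
    show "\<exists>L. ((\<lambda>x. pr (F i x) (H i x)) \<longlongrightarrow> L) at_infinity" if "i \<in> I" for i
      using holder_family0_limit[OF F that] holder_family0_limit[OF H that] tendsto by metis
  qed (rule \<sigma>_nonneg)
qed

text \<open>In the Leibniz rule each product pairs a partial derivative of order k with an
  undifferentiated factor of order k + 1; lowering the latter by one makes the induction hypothesis
  applicable. Since the undifferentiated factors converge, the products still vanish at
  infinity.\<close>

lemma holder_family_bilinear:
  assumes pr: "bounded_bilinear pr" and "holder_family I \<beta> \<sigma> k F" "holder_family I \<beta> \<sigma> k H"
  shows "holder_family I \<beta> \<sigma> k (\<lambda>i x. pr (F i x) (H i x))"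
  using assms(2-)
proof (induction k arbitrary: F H)
  case 0
  then show ?case using holder_family0_bilinear[OF pr] by simp
next
  case (Suc k)
  interpret bounded_bilinear pr by fact
  obtain G where G: "\<And>i x. i \<in> I \<Longrightarrow> (F i has_derivative (\<lambda>v. \<Sum>b\<in>Basis. (v \<bullet> b) *\<^sub>R G b i x)) (at x)"
    "\<And>b i. b \<in> Basis \<Longrightarrow> i \<in> I \<Longrightarrow> (G b i \<longlongrightarrow> 0) at_infinity"
    "\<And>b. b \<in> Basis \<Longrightarrow> holder_family I \<beta> \<sigma> k (G b)"
    using holder_family_SucE[OF Suc.prems(1)] by blast
  obtain J where J: "\<And>i x. i \<in> I \<Longrightarrow> (H i has_derivative (\<lambda>v. \<Sum>b\<in>Basis. (v \<bullet> b) *\<^sub>R J b i x)) (at x)"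
    "\<And>b i. b \<in> Basis \<Longrightarrow> i \<in> I \<Longrightarrow> (J b i \<longlongrightarrow> 0) at_infinity"
    "\<And>b. b \<in> Basis \<Longrightarrow> holder_family I \<beta> \<sigma> k (J b)"
    using holder_family_SucE[OF Suc.prems(2)] by blast
  have "((\<lambda>x. pr (F i x) (H i x)) has_derivative
      (\<lambda>v. \<Sum>b\<in>Basis. (v \<bullet> b) *\<^sub>R (pr (F i x) (J b i x) + pr (G b i x) (H i x)))) (at x)"
    if "i \<in> I" for i x
    using FDERIV[OF G(1)[OF that] J(1)[OF that], of x]
    by (simp add: scaleR_right_distrib sum.distrib sum_left sum_right scaleR_left scaleR_right)
  moreover have "((\<lambda>x. pr (F i x) (J b i x) + pr (G b i x) (H i x)) \<longlongrightarrow> 0) at_infinity"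
    if b: "b \<in> Basis" and i: "i \<in> I" for b i
  proof -
    obtain L M where "(F i \<longlongrightarrow> L) at_infinity" "(H i \<longlongrightarrow> M) at_infinity"
      using Suc.prems holder_family_limit i by metis
    then have "((\<lambda>x. pr (F i x) (J b i x) + pr (G b i x) (H i x)) \<longlongrightarrow> pr L 0 + pr 0 M) at_infinity"
      by (intro tendsto_add tendsto G(2) J(2) b i)
    then show ?thesis by (simp add: zero_left zero_right)
  qed
  moreover have "holder_family I \<beta> \<sigma> k (\<lambda>i x. pr (F i x) (J b i x) + pr (G b i x) (H i x))"
    if "b \<in> Basis" for b
    by (rule holder_family_add[OF Suc.IH[OF holder_family_pred[OF Suc.prems(1)] J(3)[OF that]]
          Suc.IH[OF G(3)[OF that] holder_family_pred[OF Suc.prems(2)]]])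
  ultimately show ?case
    using holder_family0_bilinear[OF pr, of F H] Suc.prems[THEN holder_family_imp_holder_family0]
    by (intro holder_family_SucI[where G = "\<lambda>b i x. pr (F i x) (J b i x) + pr (G b i x) (H i x)"]) auto
qed

text \<open>Passing through \<open>F i (\<Psi> j x)\<close> separates the two dependences on the
  index: the change of \<open>F\<close> at a fixed point, and the displacement of the argument,
  which \<open>F\<close> sees only through its Hoelder exponent. Hence the hypothesis on
  \<open>\<Psi>\<close> concerns the \<beta>-th power of the displacement.\<close>

lemma holder_family0_compose:
  fixes \<Psi> :: "'i \<Rightarrow> 'a::real_normed_vector \<Rightarrow> 'a"
  assumes "0 \<le> \<beta>"
    and lip: "\<And>i x y. i \<in> I \<Longrightarrow> norm (\<Psi> i x - \<Psi> i y) \<le> K * norm (x - y)"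
    and diff: "\<And>i j x. i \<in> I \<Longrightarrow> j \<in> I \<Longrightarrow> norm (\<Psi> i x - \<Psi> j x) powr \<beta> \<le> K' * \<sigma> i j"
    and lim: "\<And>i. i \<in> I \<Longrightarrow> filterlim (\<Psi> i) at_infinity at_infinity"
    and F: "holder_family0 I \<beta> \<sigma> F"
  shows "holder_family0 I \<beta> \<sigma> (\<lambda>i x. F i (\<Psi> i x))"
proof -
  obtain C where C: "C > 0"
    "\<And>i x. i \<in> I \<Longrightarrow> norm (F i x) \<le> C"
    "\<And>i x y. i \<in> I \<Longrightarrow> norm (F i x - F i y) \<le> C * norm (x - y) powr \<beta>"
    "\<And>i j x. i \<in> I \<Longrightarrow> j \<in> I \<Longrightarrow> norm (F i x - F j x) \<le> C * max 0 (\<sigma> i j)"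
    using holder_family0E[OF F] by metis
  show ?thesis
  proof (rule holder_family0I[of I _ C "C * \<bar>K\<bar> powr \<beta>" _ "C * K' + C"])
    show "norm (F i (\<Psi> i x) - F i (\<Psi> i y)) \<le> C * \<bar>K\<bar> powr \<beta> * norm (x - y) powr \<beta>" if i: "i \<in> I" for i x y
    proof -
      have "norm (\<Psi> i x - \<Psi> i y) \<le> \<bar>K\<bar> * norm (x - y)"
        by (rule order_trans[OF lip[OF i]]) (simp add: mult_right_mono)
      then have "norm (\<Psi> i x - \<Psi> i y) powr \<beta> \<le> (\<bar>K\<bar> * norm (x - y)) powr \<beta>"
        by (intro powr_mono2 assms(1)) auto
      then have "C * norm (\<Psi> i x - \<Psi> i y) powr \<beta> \<le> C * (\<bar>K\<bar> powr \<beta> * norm (x - y) powr \<beta>)"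
        using C(1) by (simp add: powr_mult)
      then show ?thesis
        using C(3)[OF i, of "\<Psi> i x" "\<Psi> i y"] by (simp add: mult.assoc)
    qed
    show "norm (F i (\<Psi> i x) - F j (\<Psi> j x)) \<le> (C * K' + C) * \<sigma> i j" if ij: "i \<in> I" "j \<in> I" for i j x
    proof -
      have "norm (F i (\<Psi> i x) - F j (\<Psi> j x)) \<le>
          norm (F i (\<Psi> i x) - F i (\<Psi> j x)) + norm (F i (\<Psi> j x) - F j (\<Psi> j x))"
        using norm_triangle_ineq[of "F i (\<Psi> i x) - F i (\<Psi> j x)" "F i (\<Psi> j x) - F j (\<Psi> j x)"]
        by simp
      moreover have "norm (F i (\<Psi> i x) - F i (\<Psi> j x)) \<le> C * (K' * \<sigma> i j)"
        by (rule order_trans[OF C(3)[OF ij(1)]]) (use diff[OF ij] C(1) in auto)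
      moreover have "norm (F i (\<Psi> j x) - F j (\<Psi> j x)) \<le> C * \<sigma> i j"
        using C(4)[OF ij, of "\<Psi> j x"] \<sigma>_nonneg[OF ij] by simp
      ultimately show ?thesis by (simp add: algebra_simps)
    qed
    show "\<exists>L. ((\<lambda>x. F i (\<Psi> i x)) \<longlongrightarrow> L) at_infinity" if "i \<in> I" for i
      using holder_family0_limit[OF F that] filterlim_compose[OF _ lim[OF that]] by metis
  qed (use C \<sigma>_nonneg in auto)
qed

text \<open>By the chain rule the partial derivatives of the composition are sums of entries of
  \<open>B\<close> times partial derivatives of \<open>F\<close> composed with
  \<open>\<Psi>\<close>. Order k thus needs \<open>B\<close> only below k, and this strict
  inequality makes the later bootstrap well founded.\<close>

lemma holder_family_compose:
  fixes \<Psi> :: "'i \<Rightarrow> 'a::euclidean_space \<Rightarrow> 'a" and B :: "'i \<Rightarrow> 'a \<Rightarrow> ('a \<Rightarrow>\<^sub>L 'a)"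
  assumes "0 \<le> \<beta>"
    and "\<And>i x y. i \<in> I \<Longrightarrow> norm (\<Psi> i x - \<Psi> i y) \<le> K * norm (x - y)"
    and "\<And>i j x. i \<in> I \<Longrightarrow> j \<in> I \<Longrightarrow> norm (\<Psi> i x - \<Psi> j x) powr \<beta> \<le> K' * \<sigma> i j"
    and lim: "\<And>i. i \<in> I \<Longrightarrow> filterlim (\<Psi> i) at_infinity at_infinity"
    and deriv: "\<And>i x. i \<in> I \<Longrightarrow> (\<Psi> i has_derivative blinfun_apply (B i x)) (at x)"
    and B: "\<And>j. j < k \<Longrightarrow> holder_family I \<beta> \<sigma> j B"
    and F: "holder_family I \<beta> \<sigma> k F"
  shows "holder_family I \<beta> \<sigma> k (\<lambda>i x. F i (\<Psi> i x))"
  using B F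
proof (induction k arbitrary: F)
  case 0
  then show ?case
    using holder_family0_compose[OF assms(1-4)] by simp
next
  case (Suc k)
  obtain G where G: "\<And>i x. i \<in> I \<Longrightarrow> (F i has_derivative (\<lambda>v. \<Sum>b\<in>Basis. (v \<bullet> b) *\<^sub>R G b i x)) (at x)"
    "\<And>b i. b \<in> Basis \<Longrightarrow> i \<in> I \<Longrightarrow> (G b i \<longlongrightarrow> 0) at_infinity"
    "\<And>b. b \<in> Basis \<Longrightarrow> holder_family I \<beta> \<sigma> k (G b)"
    using holder_family_SucE[OF Suc.prems(2)] by blast
  have B: "holder_family I \<beta> \<sigma> k B" using Suc.prems(1) by blast
  \<comment> \<open>The partial derivative along \<open>b\<close>: column \<open>b\<close> of the
    Jacobian \<open>B\<close> weights the partial derivatives of \<open>F\<close> at the image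
    point.\<close>
  define H where "H = (\<lambda>b i x. \<Sum>r\<in>Basis. (B i x b \<bullet> r) *\<^sub>R G r i (\<Psi> i x))"
  have "((\<lambda>x. F i (\<Psi> i x)) has_derivative (\<lambda>v. \<Sum>b\<in>Basis. (v \<bullet> b) *\<^sub>R H b i x)) (at x)"
    if i: "i \<in> I" for i x
  proof -
    have "(\<Sum>r\<in>Basis. (B i x v \<bullet> r) *\<^sub>R G r i (\<Psi> i x)) = (\<Sum>b\<in>Basis. (v \<bullet> b) *\<^sub>R H b i x)" for v
    proof -
      have "B i x v = B i x (\<Sum>b\<in>Basis. (v \<bullet> b) *\<^sub>R b)"
        by (simp add: euclidean_representation)
      also have "\<dots> = (\<Sum>b\<in>Basis. (v \<bullet> b) *\<^sub>R B i x b)"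
        by (simp add: blinfun.sum_right blinfun.scaleR_right)
      finally show ?thesis
        unfolding H_def by (simp add: inner_sum_left scaleR_sum_left scaleR_sum_right) (rule sum.swap)
    qed
    with has_derivative_compose[OF deriv[OF i] G(1)[OF i], of x] show ?thesis
      by simp
  qed
  moreover have "(H b i \<longlongrightarrow> 0) at_infinity" if b: "b \<in> Basis" and i: "i \<in> I" for b i
  proof -
    obtain L where L: "(B i \<longlongrightarrow> L) at_infinity"
      using holder_family_limit[OF B i] by blast
    have "(H b i \<longlongrightarrow> (\<Sum>r\<in>Basis. (L b \<bullet> r) *\<^sub>R 0)) at_infinity"
      unfolding H_def
      by (intro tendsto_sum tendsto_scaleR tendsto_inner blinfun.tendsto L tendsto_const
          filterlim_compose[OF G(2) lim] i)
    then show ?thesis by simp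
  qed
  moreover have "holder_family I \<beta> \<sigma> k (H b)" for b
    unfolding H_def
  proof (intro holder_family_sum holder_family_bilinear[OF bounded_bilinear_scaleR])
    show "holder_family I \<beta> \<sigma> k (\<lambda>i x. B i x b \<bullet> r)" for r
      by (rule holder_family_linear[OF bounded_linear_compose[OF bounded_linear_inner_left blinfun.bounded_linear_left] B])
    show "holder_family I \<beta> \<sigma> k (\<lambda>i x. G r i (\<Psi> i x))" if "r \<in> Basis" for r
      by (rule Suc.IH[OF Suc.prems(1) G(3)[OF that]]) auto
  qed
  moreover have "holder_family0 I \<beta> \<sigma> (\<lambda>i x. F i (\<Psi> i x))"
    by (rule holder_family0_compose[OF assms(1-4) holder_family_imp_holder_family0[OF Suc.prems(2)]])
  ultimately show ?case
    unfolding holder_family.simps(2) by blast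
qed

end

section \<open>Inversion of operator-valued families\<close>

lemma blinfun_compose_assoc: "(a o\<^sub>L b) o\<^sub>L c = a o\<^sub>L (b o\<^sub>L c)"
  by (rule blinfun_eqI) simp

lemma blinfun_compose_id [simp]: "a o\<^sub>L id_blinfun = a" "id_blinfun o\<^sub>L a = a"
  by (rule blinfun_eqI, simp)+

text \<open>The resolvent identity: a left inverse of \<open>A\<close> and a right inverse of
  \<open>A'\<close> cancel the outer factors. Inversion is therefore Lipschitz on any set where the
  inverses stay bounded.\<close>

lemma blinfun_inverse_diff:
  assumes "B o\<^sub>L A = id_blinfun" "A' o\<^sub>L B' = id_blinfun"
  shows "B - B' = B o\<^sub>L (A' - A) o\<^sub>L B'"
proof -
  have "B o\<^sub>L (A' - A) o\<^sub>L B' = (B o\<^sub>L (A' o\<^sub>L B')) - ((B o\<^sub>L A) o\<^sub>L B')"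
    by (rule blinfun_eqI) (simp add: blinfun.bilinear_simps)
  then show ?thesis using assms by simp
qed

lemma norm_blinfun_inverse_diff:
  assumes "B o\<^sub>L A = id_blinfun" "A' o\<^sub>L B' = id_blinfun" "norm B \<le> K" "norm B' \<le> K"
  shows "norm (B - B') \<le> K * K * norm (A - A')"
proof -
  have "K \<ge> 0" using assms(3) norm_ge_zero order_trans by blast
  have "norm (B - B') \<le> norm (B o\<^sub>L (A' - A)) * norm B'"
    unfolding blinfun_inverse_diff[OF assms(1,2)] by (rule norm_blinfun_compose)
  also have "\<dots> \<le> (norm B * norm (A' - A)) * norm B'"
    by (intro mult_right_mono norm_blinfun_compose) auto
  also have "\<dots> \<le> (K * norm (A' - A)) * K"
    using assms \<open>K \<ge> 0\<close> by (intro mult_mono) auto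
  finally show ?thesis by (simp add: norm_minus_commute mult_ac)
qed

lemma has_derivative_blinfun_inverse:
  fixes A B :: "'a::real_normed_vector \<Rightarrow> ('b::real_normed_vector \<Rightarrow>\<^sub>L 'b)"
  assumes A: "(A has_derivative A') (at x)"
    and inv: "\<And>y. B y o\<^sub>L A y = id_blinfun" "\<And>y. A y o\<^sub>L B y = id_blinfun"
    and bound: "\<And>y. norm (B y) \<le> K"
  shows "(B has_derivative (\<lambda>v. - (B x o\<^sub>L A' v o\<^sub>L B x))) (at x)"
proof -
  interpret A': bounded_linear A' using A by (rule has_derivative_bounded_linear)
  interpret c: bounded_bilinear "(o\<^sub>L) :: 'b \<Rightarrow>\<^sub>L 'b \<Rightarrow> 'b \<Rightarrow>\<^sub>L 'b \<Rightarrow> _" by (rule bounded_bilinear_blinfun_compose)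
  \<comment> \<open>\<open>B y - B x = - B y (A y - A x) B x\<close>, and the factor \<open>A y - A x\<close> vanishes at \<open>x\<close>, so that only
    continuity of \<open>B\<close> is needed to differentiate the product.\<close>
  define M where "M = (\<lambda>y. (A y - A x) o\<^sub>L B x)"
  have contA: "(A \<longlongrightarrow> A x) (at x)"
    using has_derivative_continuous[OF A] by (simp add: continuous_at)
  have "((\<lambda>y. K * K * norm (A y - A x)) \<longlongrightarrow> 0) (at x)"
    using tendsto_mult_left[OF tendsto_norm_zero[OF LIM_zero[OF contA]], of "K * K"] by simp
  then have contB: "((\<lambda>y. B y - B x) \<longlongrightarrow> 0) (at x)"
    by (rule Lim_null_comparison[rotated])
      (simp add: norm_blinfun_inverse_diff[OF inv bound bound])
  have M: "(M has_derivative (\<lambda>v. A' v o\<^sub>L B x)) (at x)"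
    unfolding M_def
    using bounded_linear.has_derivative[OF c.bounded_linear_left has_derivative_diff[OF A has_derivative_const]]
    by simp
  have q: "((\<lambda>y. (M y - M x - (A' (y - x) o\<^sub>L B x)) /\<^sub>R norm (y - x)) \<longlongrightarrow> 0) (at x)"
    using M by (simp add: has_derivative_at_within)
  have Mx: "M x = 0" by (simp add: M_def c.zero_left)
  obtain K' where K': "\<And>v. norm (A' v o\<^sub>L B x) \<le> norm v * K'"
    using bounded_linear.bounded[OF has_derivative_bounded_linear[OF M]] by blast
  define q' where "q' = (\<lambda>y. (M y - M x - (A' (y - x) o\<^sub>L B x)) /\<^sub>R norm (y - x))"
  \<comment> \<open>The remainder quotient of \<open>B\<close>, split into the remainder quotient of
    \<open>M\<close> multiplied by the bounded \<open>B y\<close>, and the increment of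
    \<open>B\<close> multiplied by the bounded quotient of \<open>A'\<close>. Both parts tend to
    zero.\<close>
  define e where "e = (\<lambda>y. - (B y o\<^sub>L q' y) - ((B y - B x) o\<^sub>L (A' (y - x) o\<^sub>L B x)) /\<^sub>R norm (y - x))"
  have "((\<lambda>y. B y o\<^sub>L q' y) \<longlongrightarrow> 0) (at x)"
  proof (rule Lim_null_comparison)
    show "((\<lambda>y. K * norm (q' y)) \<longlongrightarrow> 0) (at x)"
      using tendsto_mult_left[OF tendsto_norm_zero[OF q], of K] by (simp add: q'_def)
    show "\<forall>\<^sub>F y in at x. norm (B y o\<^sub>L q' y) \<le> K * norm (q' y)"
      by (rule always_eventually) (meson bound mult_right_mono norm_blinfun_compose norm_ge_zero order_trans)
  qed
  moreover have "((\<lambda>y. ((B y - B x) o\<^sub>L (A' (y - x) o\<^sub>L B x)) /\<^sub>R norm (y - x)) \<longlongrightarrow> 0) (at x)"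
  proof (rule Lim_null_comparison)
    show "((\<lambda>y. norm (B y - B x) * K') \<longlongrightarrow> 0) (at x)"
      using tendsto_mult_right[OF tendsto_norm_zero[OF contB], of K'] by simp
    have "norm (((B y - B x) o\<^sub>L (A' (y - x) o\<^sub>L B x)) /\<^sub>R norm (y - x)) \<le> norm (B y - B x) * K'"
      if "y \<noteq> x" for y
    proof -
      have "norm ((B y - B x) o\<^sub>L (A' (y - x) o\<^sub>L B x)) \<le> norm (B y - B x) * (norm (y - x) * K')"
        by (meson K' mult_left_mono norm_blinfun_compose norm_ge_zero order_trans)
      then show ?thesis
        using that by (simp add: field_simps)
    qed
    then show "\<forall>\<^sub>F y in at x. norm (((B y - B x) o\<^sub>L (A' (y - x) o\<^sub>L B x)) /\<^sub>R norm (y - x)) \<le> norm (B y - B x) * K'"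
      by (simp add: eventually_at_filter)
  qed
  ultimately have "(e \<longlongrightarrow> - 0 - 0) (at x)"
    unfolding e_def by (intro tendsto_diff tendsto_minus)
  moreover have "(B y - B x - - (B x o\<^sub>L A' (y - x) o\<^sub>L B x)) /\<^sub>R norm (y - x) = e y" for y
  proof -
    have "B y - B x = - (B y o\<^sub>L M y)"
      using blinfun_inverse_diff[OF inv(1)[of y] inv(2)[of x]]
      by (simp add: M_def blinfun_compose_assoc c.diff_left c.diff_right c.minus_right c.minus_left)
    moreover have "B y o\<^sub>L q' y = ((B y o\<^sub>L M y) - (B y o\<^sub>L (A' (y - x) o\<^sub>L B x))) /\<^sub>R norm (y - x)"
      unfolding q'_def by (simp add: c.scaleR_right c.diff_right Mx)
    ultimately have eq: "B y o\<^sub>L q' y = - (B y - B x) /\<^sub>R norm (y - x) - (B y o\<^sub>L (A' (y - x) o\<^sub>L B x)) /\<^sub>R norm (y - x)"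
      by (simp add: scaleR_right_diff_distrib)
    show ?thesis
      unfolding e_def eq
      by (simp add: blinfun_compose_assoc c.diff_left scaleR_right_diff_distrib scaleR_right_distrib)
  qed
  ultimately have "((\<lambda>y. (B y - B x - - (B x o\<^sub>L A' (y - x) o\<^sub>L B x)) /\<^sub>R norm (y - x)) \<longlongrightarrow> 0) (at x)"
    by simp
  moreover have "bounded_linear (\<lambda>v. - (B x o\<^sub>L A' v o\<^sub>L B x))"
    by (intro bounded_linear_minus bounded_linear_compose[OF c.bounded_linear_left]
        bounded_linear_compose[OF c.bounded_linear_right] A'.bounded_linear_axioms)
  ultimately show ?thesis
    by (simp add: has_derivative_at_within)
qed

text \<open>The derivative of the inverse is -B G B, which involves \<open>B\<close> at the order
  already reached and the partial derivatives \<open>G\<close> of \<open>A\<close>, so an induction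
  on the order closes. The prescribed limit of \<open>B\<close> supplies the limit required at order
  0 and lets the decay of \<open>G\<close> pass to -B G B.\<close>

lemma holder_family_inverse:
  fixes A B :: "'i \<Rightarrow> 'a::euclidean_space \<Rightarrow> ('b::real_normed_vector \<Rightarrow>\<^sub>L 'b)"
  assumes \<sigma>: "\<And>i j. i \<in> I \<Longrightarrow> j \<in> I \<Longrightarrow> 0 \<le> \<sigma> i j"
    and inv: "\<And>i y. i \<in> I \<Longrightarrow> B i y o\<^sub>L A i y = id_blinfun" "\<And>i y. i \<in> I \<Longrightarrow> A i y o\<^sub>L B i y = id_blinfun"
    and bound: "\<And>i y. i \<in> I \<Longrightarrow> norm (B i y) \<le> K"
    and lim: "\<And>i. i \<in> I \<Longrightarrow> (B i \<longlongrightarrow> id_blinfun) at_infinity"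
    and A: "holder_family I \<beta> \<sigma> k A"
  shows "holder_family I \<beta> \<sigma> k B"
proof -
  have B0: "holder_family0 I \<beta> \<sigma> B"
  proof -
    obtain C where C: "C > 0"
      "\<And>i x y. i \<in> I \<Longrightarrow> norm (A i x - A i y) \<le> C * norm (x - y) powr \<beta>"
      "\<And>i j x. i \<in> I \<Longrightarrow> j \<in> I \<Longrightarrow> norm (A i x - A j x) \<le> C * max 0 (\<sigma> i j)"
      using holder_family0E[OF holder_family_imp_holder_family0[OF A]] by metis
    have *: "K * K * a \<le> K * K * C * t" if "a \<le> C * t" for a t
      using mult_left_mono[OF that, of "K * K"] by (simp add: mult.assoc)
    show ?thesis
    proof (rule holder_family0I[of I _ K "K * K * C" _ "K * K * C"])
      show "norm (B i x - B i y) \<le> K * K * C * norm (x - y) powr \<beta>" if "i \<in> I" for i x y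
        by (rule order_trans[OF norm_blinfun_inverse_diff[OF inv bound bound] *[OF C(2)]]) (use that in auto)
      show "norm (B i x - B j x) \<le> K * K * C * \<sigma> i j" if "i \<in> I" "j \<in> I" for i j x
        by (rule order_trans[OF norm_blinfun_inverse_diff[OF inv bound bound] *])
          (use C(3)[OF that, of x] that \<sigma>[OF that] in auto)
    qed (use bound lim \<sigma> in auto)
  qed
  show ?thesis
    using A
  proof (induction k)
    case 0
    then show ?case using B0 by simp
  next
    case (Suc k)
    interpret c: bounded_bilinear "(o\<^sub>L) :: 'b \<Rightarrow>\<^sub>L 'b \<Rightarrow> 'b \<Rightarrow>\<^sub>L 'b \<Rightarrow> _" by (rule bounded_bilinear_blinfun_compose)
    obtain G where G: "\<And>i x. i \<in> I \<Longrightarrow> (A i has_derivative (\<lambda>v. \<Sum>b\<in>Basis. (v \<bullet> b) *\<^sub>R G b i x)) (at x)"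
      "\<And>b i. b \<in> Basis \<Longrightarrow> i \<in> I \<Longrightarrow> (G b i \<longlongrightarrow> 0) at_infinity"
      "\<And>b. b \<in> Basis \<Longrightarrow> holder_family I \<beta> \<sigma> k (G b)"
      using holder_family_SucE[OF Suc.prems] by blast
    have B: "holder_family I \<beta> \<sigma> k B" using Suc holder_family_pred by blast
    define H where "H = (\<lambda>b i x. - (B i x o\<^sub>L G b i x o\<^sub>L B i x))"
    have "(B i has_derivative (\<lambda>v. \<Sum>b\<in>Basis. (v \<bullet> b) *\<^sub>R H b i x)) (at x)" if i: "i \<in> I" for i x
      using has_derivative_blinfun_inverse[OF G(1)[OF i] inv[OF i] bound[OF i], of x]
      by (simp add: H_def c.sum_left c.sum_right c.scaleR_left c.scaleR_right sum_negf)
    moreover have "(H b i \<longlongrightarrow> 0) at_infinity" if b: "b \<in> Basis" and i: "i \<in> I" for b i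
    proof -
      have "(H b i \<longlongrightarrow> - (id_blinfun o\<^sub>L 0 o\<^sub>L id_blinfun)) at_infinity"
        unfolding H_def by (intro tendsto_minus c.tendsto lim G(2) i b)
      then show ?thesis by simp
    qed
    moreover have "holder_family I \<beta> \<sigma> k (H b)" if "b \<in> Basis" for b
      unfolding H_def
      by (intro holder_family_linear[OF \<sigma> bounded_linear_minus[OF bounded_linear_ident]]
          holder_family_bilinear[OF \<sigma> bounded_bilinear_blinfun_compose] B G(3) that)
    ultimately show ?case
      using B0 unfolding holder_family.simps(2) by blast
  qed
qed

section \<open>Global inverses of maps asymptotic to the identity\<close>

lemma linear_blinfun: "linear (blinfun_apply T)"
  by (rule bounded_linear.linear[OF blinfun.bounded_linear_right])

lemma blinfun_left_inverse:
  fixes T :: "'a::euclidean_space \<Rightarrow>\<^sub>L 'a"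
  assumes "inj (blinfun_apply T)"
  obtains S where "S o\<^sub>L T = id_blinfun" "T o\<^sub>L S = id_blinfun"
proof -
  obtain g where g: "linear g" "g \<circ> blinfun_apply T = id"
    using linear_injective_left_inverse[OF linear_blinfun assms] by auto
  then have g': "blinfun_apply (Blinfun g) = g"
    by (simp add: bounded_linear_Blinfun_apply linear_conv_bounded_linear)
  have "blinfun_apply T \<circ> g = id"
    using g by (simp add: linear_blinfun linear_inverse_left)
  then show ?thesis
    using g g' by (intro that[of "Blinfun g"] blinfun_eqI) (auto simp: fun_eq_iff)
qed

lemma inj_of_lower_bound:
  fixes T :: "'a::real_normed_vector \<Rightarrow>\<^sub>L 'b::real_normed_vector"
  assumes "m > 0" "\<And>v. m * norm v \<le> norm (T v)"
  shows "inj (blinfun_apply T)"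
proof -
  have "v = 0" if "T v = 0" for v
    using assms(2)[of v] that assms(1) by (simp add: mult_le_0_iff)
  then show ?thesis
    by (simp add: linear_injective_0 linear_blinfun)
qed

text \<open>Bounded distance from the identity makes \<open>f\<close> proper, and the inverse
  function theorem makes it a local homeomorphism. Openness and properness give surjectivity by
  connectedness; injectivity needs in addition one point with a single preimage, which the limit of
  \<open>A\<close> provides. Openness is kept as a conclusion because it yields continuity of the
  inverse.\<close>

lemma bij_near_identity_at_infinity:
  fixes f :: "'a::euclidean_space \<Rightarrow> 'a" and A :: "'a \<Rightarrow> ('a \<Rightarrow>\<^sub>L 'a)"
  assumes deriv: "\<And>x. (f has_derivative blinfun_apply (A x)) (at x)"
    and cont: "continuous_on UNIV A"
    and inj: "\<And>x. inj (blinfun_apply (A x))"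
    and bound: "\<And>x. norm (f x - x) \<le> C"
    and lim: "(A \<longlongrightarrow> id_blinfun) at_infinity"
  shows "bij f" "\<And>W. open W \<Longrightarrow> open (f ` W)"
proof -
  have contf: "continuous_on UNIV f"
    by (intro continuous_at_imp_continuous_on ballI has_derivative_continuous[OF deriv])
  have loc: "\<exists>U. open U \<and> x \<in> U \<and> U \<subseteq> W \<and> inj_on f U \<and> open (f ` U)" if W: "open W" "x \<in> W" for x W
  proof -
    obtain S where S: "S o\<^sub>L A x = id_blinfun" "A x o\<^sub>L S = id_blinfun"
      by (rule blinfun_left_inverse[OF inj])
    show ?thesis
    proof (rule inverse_function_theorem[OF W(1) deriv continuous_on_subset[OF cont subset_UNIV] W(2) S(1)])
      fix U V g assume "open U" "U \<subseteq> W" "x \<in> U" "open V" "homeomorphism U V f g"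
      then show ?thesis
        by (intro exI[of _ U]) (auto simp: homeomorphism_def intro: inj_on_inverseI)
    qed
  qed
  show open_map: "open (f ` W)" if W: "open W" for W
    unfolding open_subopen[of "f ` W"]
  proof
    fix y assume "y \<in> f ` W"
    then obtain x where x: "x \<in> W" "y = f x" by blast
    then obtain U where "x \<in> U" "U \<subseteq> W" "open (f ` U)"
      using loc[OF W x(1)] by blast
    then show "\<exists>T. open T \<and> y \<in> T \<and> T \<subseteq> f ` W"
      using x by (intro exI[of _ "f ` U"]) auto
  qed
  \<comment> \<open>Properness in sequential form: \<open>f x - x\<close> is bounded, so a sequence
    with convergent images is itself bounded and has a convergent subsequence.\<close>
  have proper: "\<exists>l r. strict_mono r \<and> (\<lambda>k. x (r k)) \<longlonglongrightarrow> l \<and> f l = y"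
    if y: "(\<lambda>k::nat. f (x k)) \<longlonglongrightarrow> y" for x y
  proof -
    obtain M where M: "\<forall>k. norm (f (x k)) \<le> M"
      using convergent_imp_Bseq[OF convergentI[OF y]] by (auto simp: Bseq_def)
    have "norm (x k) \<le> M + C" for k
      using M[rule_format, of k] bound[of "x k"] norm_triangle_ineq4[of "f (x k)" "f (x k) - x k"] by simp
    then have "bounded (range x)"
      by (auto simp: bounded_iff)
    then obtain l r where lr: "strict_mono (r :: nat \<Rightarrow> nat)" "(x \<circ> r) \<longlonglongrightarrow> l"
      using bounded_imp_convergent_subsequence[of x] by blast
    have "(\<lambda>k. f ((x \<circ> r) k)) \<longlonglongrightarrow> f l"
      by (rule continuous_on_tendsto_compose[OF contf lr(2)]) auto
    moreover have "(\<lambda>k. f ((x \<circ> r) k)) \<longlonglongrightarrow> y"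
      using LIMSEQ_subseq_LIMSEQ[OF y lr(1)] by (simp add: o_def)
    ultimately show ?thesis
      using lr LIMSEQ_unique unfolding o_def by blast
  qed
  have "closed (range f)"
    unfolding closed_sequential_limits
  proof (intro allI impI, elim conjE)
    fix s y assume "\<forall>n. s n \<in> range f" and s: "s \<longlonglongrightarrow> y"
    then have "\<forall>n. \<exists>x. s n = f x" by blast
    from choice[OF this] obtain x where "s = (\<lambda>n. f (x n))" by auto
    with s have "(\<lambda>n. f (x n)) \<longlonglongrightarrow> y" by simp
    from proper[OF this] show "y \<in> range f" by blast
  qed
  then have surj: "range f = UNIV"
    using open_map[OF open_UNIV] clopen[of "range f"] by blast
  \<comment> \<open>The set of points with at least two preimages is open and closed, and misses all large points.\<close>
  define S where "S = {y. \<exists>x x'. x \<noteq> x' \<and> f x = y \<and> f x' = y}"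
  have "open S"
    unfolding open_subopen[of S]
  proof
    fix y assume "y \<in> S"
    then obtain x x' where x: "x \<noteq> x'" "f x = y" "f x' = y" by (auto simp: S_def)
    then obtain U U' where U: "open U" "open U'" "x \<in> U" "x' \<in> U'" "U \<inter> U' = {}"
      by (metis hausdorff)
    have "f ` U \<inter> f ` U' \<subseteq> S"
    proof
      fix z assume "z \<in> f ` U \<inter> f ` U'"
      then obtain w w' where "w \<in> U" "w' \<in> U'" "f w = z" "f w' = z" by auto
      moreover from this have "w \<noteq> w'" using U(5) by auto
      ultimately show "z \<in> S" by (auto simp: S_def)
    qed
    then show "\<exists>T. open T \<and> y \<in> T \<and> T \<subseteq> S"
      using open_Int[OF open_map[OF U(1)] open_map[OF U(2)]] imageI[OF U(3), of f] imageI[OF U(4), of f] x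
      by (intro exI[of _ "f ` U \<inter> f ` U'"]) auto
  qed
  moreover have "closed S"
    unfolding closed_sequential_limits
  proof (intro allI impI, elim conjE)
    fix s y assume "\<forall>n. s n \<in> S" and s: "s \<longlonglongrightarrow> y"
    then have "\<forall>n. \<exists>p. fst p \<noteq> snd p \<and> f (fst p) = s n \<and> f (snd p) = s n"
      by (simp add: S_def)
    from choice[OF this] obtain p where
      p: "\<And>n. fst (p n) \<noteq> snd (p n)" "\<And>n. f (fst (p n)) = s n" "\<And>n. f (snd (p n)) = s n"
      by blast
    define x x' where "x n = fst (p n)" and "x' n = snd (p n)" for n
    have x: "x n \<noteq> x' n" "f (x n) = s n" "f (x' n) = s n" for n
      using p by (auto simp: x_def x'_def)
    have "(\<lambda>n. f (x n)) \<longlonglongrightarrow> y" using s by (simp add: x(2))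
    from proper[OF this] obtain l r where l: "strict_mono r" "(\<lambda>k. x (r k)) \<longlonglongrightarrow> l" "f l = y"
      by blast
    \<comment> \<open>A further subsequence makes the second preimages converge as well, while the
      first ones keep their limit \<open>l\<close>.\<close>
    have "(\<lambda>n. f (x' (r n))) \<longlonglongrightarrow> y"
      using LIMSEQ_subseq_LIMSEQ[OF s l(1)] by (simp add: o_def x(3))
    from proper[OF this] obtain l' q where l': "strict_mono q" "(\<lambda>k. x' (r (q k))) \<longlonglongrightarrow> l'" "f l' = y"
      by blast
    have lq: "(\<lambda>k. x (r (q k))) \<longlonglongrightarrow> l"
      using LIMSEQ_subseq_LIMSEQ[OF l(2) l'(1)] by (simp add: o_def)
    \<comment> \<open>If the limits agreed, both preimages would eventually lie in one neighbourhood
      on which \<open>f\<close> is injective.\<close>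
    have "l \<noteq> l'"
    proof
      assume eq: "l = l'"
      obtain U where U: "open U" "l \<in> U" "inj_on f U"
        using loc[OF open_UNIV UNIV_I, of l] by blast
      have "\<forall>\<^sub>F k in sequentially. x (r (q k)) \<in> U \<and> x' (r (q k)) \<in> U"
        using topological_tendstoD[OF lq U(1,2)] topological_tendstoD[OF l'(2) U(1)] U(2) eq
        by (auto intro: eventually_conj)
      then obtain k where "x (r (q k)) \<in> U" "x' (r (q k)) \<in> U"
        using eventually_happens'[OF sequentially_bot] by blast
      then have "x (r (q k)) = x' (r (q k))"
        using inj_onD[OF U(3), of "x (r (q k))" "x' (r (q k))"] x(2,3) by simp
      then show False using x(1) by blast
    qed
    then show "y \<in> S" using l(3) l'(3) by (auto simp: S_def)
  qed
  moreover have "S \<noteq> UNIV"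
  proof -
    have "\<forall>\<^sub>F x in at_infinity. dist (A x) id_blinfun < 1/2"
      using tendstoD[OF lim, of "1/2"] by simp
    then obtain R where R: "\<And>x. R \<le> norm x \<Longrightarrow> dist (A x) id_blinfun < 1/2"
      unfolding eventually_at_infinity by blast
    have "C \<ge> 0" using order_trans[OF norm_ge_zero bound] .
    \<comment> \<open>Every preimage of \<open>y\<close> lies within \<open>C\<close> of
      \<open>y\<close>, and this norm keeps that ball in the region where \<open>A\<close> is within
      1/2 of the identity. There f - id contracts by 1/2, so two preimages must coincide.\<close>
    obtain y :: 'a where y: "norm y = \<bar>R\<bar> + C"
      using vector_choose_size[of "\<bar>R\<bar> + C"] \<open>C \<ge> 0\<close> by auto
    have "x = x'" if "f x = y" "f x' = y" for x x'
    proof -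
      have x: "x \<in> cball y C" "x' \<in> cball y C"
        using bound[of x] bound[of x'] that by (auto simp: dist_norm)
      have "norm ((f x - x) - (f x' - x')) \<le> 1/2 * norm (x - x')"
      proof (rule differentiable_bound[OF convex_cball _ _ x])
        fix z assume z: "z \<in> cball y C"
        show "((\<lambda>x. f x - x) has_derivative blinfun_apply (A z - id_blinfun)) (at z within cball y C)"
          using has_derivative_diff[OF has_derivative_at_withinI[OF deriv] has_derivative_ident]
          by (simp add: minus_blinfun.rep_eq)
        have "R \<le> norm z"
          using z y norm_triangle_ineq2[of y "y - z"] by (simp add: dist_norm)
        then show "onorm (blinfun_apply (A z - id_blinfun)) \<le> 1/2"
          using R[of z] by (simp add: dist_norm norm_blinfun.rep_eq)
      qed
      then show ?thesis
        using that by (simp add: norm_minus_commute)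
    qed
    then have "y \<notin> S" by (auto simp: S_def)
    then show ?thesis by blast
  qed
  ultimately have "S = {}"
    using clopen[of S] by blast
  then have "inj f"
    unfolding S_def inj_def by blast
  then show "bij f"
    using surj by (simp add: bij_def)
qed

text \<open>The lower bound \<open>m\<close> does double duty: it makes every differential
  invertible and bounds the inverses by \<open>1 / m\<close>, the later common Lipschitz constant of
  the inverse maps. Differentiating \<open>inv f\<close> presupposes its continuity, which follows
  from \<open>f\<close> being an open bijection.\<close>

lemma global_inverse_derivative:
  fixes f :: "'a::euclidean_space \<Rightarrow> 'a" and A :: "'a \<Rightarrow> ('a \<Rightarrow>\<^sub>L 'a)"
  assumes deriv: "\<And>x. (f has_derivative blinfun_apply (A x)) (at x)"
    and cont: "continuous_on UNIV A"
    and m: "m > 0" "\<And>x v. m * norm v \<le> norm (A x v)"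
    and bound: "\<And>x. norm (f x - x) \<le> C"
    and lim: "(A \<longlongrightarrow> id_blinfun) at_infinity"
  obtains B where "bij f"
    "\<And>y. (inv f has_derivative blinfun_apply (B y)) (at y)"
    "\<And>y. B y o\<^sub>L A (inv f y) = id_blinfun" "\<And>y. A (inv f y) o\<^sub>L B y = id_blinfun"
    "\<And>y. norm (B y) \<le> 1 / m"
proof -
  have inj: "inj (blinfun_apply (A x))" for x
    by (rule inj_of_lower_bound[OF m])
  note bij = bij_near_identity_at_infinity[OF deriv cont inj bound lim]
  have inv: "f (inv f y) = y" "inv f (f x) = x" for x y
    using bij(1) by (auto simp: bij_is_surj surj_f_inv_f bij_is_inj)
  have "\<forall>x. \<exists>S. S o\<^sub>L A x = id_blinfun \<and> A x o\<^sub>L S = id_blinfun"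
    using blinfun_left_inverse[OF inj] by metis
  then obtain S where S: "\<And>x. S x o\<^sub>L A x = id_blinfun" "\<And>x. A x o\<^sub>L S x = id_blinfun"
    by metis
  have contf: "continuous_on UNIV f"
    by (intro continuous_at_imp_continuous_on ballI has_derivative_continuous[OF deriv])
  have "continuous_on UNIV (inv f)"
    by (rule continuous_on_inverse_open_map[OF contf]) (use bij inv in \<open>auto simp: bij_is_surj\<close>)
  then have cinv: "isCont (inv f) y" for y
    by (simp add: continuous_on_eq_continuous_at)
  show ?thesis
  proof (rule that[of "\<lambda>y. S (inv f y)"])
    show "(inv f has_derivative blinfun_apply (S (inv f y))) (at y)" for y
    proof (rule has_derivative_inverse_basic[OF deriv _ _ cinv open_UNIV UNIV_I inv(1)])
      show "blinfun_apply (S (inv f y)) \<circ> blinfun_apply (A (inv f y)) = id"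
        using S(1)[of "inv f y"] by (metis blinfun_apply_id_blinfun blinfun_compose.rep_eq eq_id_iff)
    qed (rule blinfun.bounded_linear_right)
    show "norm (S (inv f y)) \<le> 1 / m" for y
    proof (rule norm_blinfun_bound)
      fix v
      have "A (inv f y) (S (inv f y) v) = v"
        using S(2)[of "inv f y"] by (metis blinfun_apply_blinfun_compose blinfun_apply_id_blinfun)
      then show "norm (S (inv f y) v) \<le> 1 / m * norm v"
        using m(2)[of "S (inv f y) v" "inv f y"] m(1) by (simp add: field_simps)
    qed (use m in simp)
  qed (use bij(1) S in auto)
qed

text \<open>Outside a large ball, closeness to the identity gives the constant 1/2. Over the ball,
  \<open>norm (A x v)\<close> attains a positive minimum on the compact product with the unit
  sphere.\<close>

lemma uniform_lower_bound:
  fixes A :: "'a::euclidean_space \<Rightarrow> ('a \<Rightarrow>\<^sub>L 'a)"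
  assumes cont: "continuous_on UNIV A"
    and inj: "\<And>x. inj (blinfun_apply (A x))"
    and lim: "(A \<longlongrightarrow> id_blinfun) at_infinity"
  obtains m where "m > 0" "\<And>x v. m * norm v \<le> norm (A x v)"
proof -
  have "\<forall>\<^sub>F x in at_infinity. dist (A x) id_blinfun < 1/2"
    using tendstoD[OF lim, of "1/2"] by simp
  then obtain R where R: "\<And>x. R \<le> norm x \<Longrightarrow> dist (A x) id_blinfun < 1/2"
    unfolding eventually_at_infinity by blast
  let ?K = "cball (0::'a) \<bar>R\<bar> \<times> sphere (0::'a) 1"
  have "continuous_on ?K (\<lambda>p. norm (A (fst p) (snd p)))"
    by (intro continuous_intros continuous_on_compose2[OF cont]) auto
  moreover have "compact ?K"
    by (intro compact_Times compact_cball compact_sphere)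
  moreover have "?K \<noteq> {}"
    using vector_choose_size[of 1] by auto
  ultimately obtain p where p: "p \<in> ?K" "\<And>q. q \<in> ?K \<Longrightarrow> norm (A (fst p) (snd p)) \<le> norm (A (fst q) (snd q))"
    using continuous_attains_inf[of ?K "\<lambda>p. norm (A (fst p) (snd p))"] by metis
  define m where "m = min (1/2) (norm (A (fst p) (snd p)))"
  have "snd p \<noteq> 0" using p(1) by auto
  then have "A (fst p) (snd p) \<noteq> 0"
    using inj[of "fst p"] by (metis blinfun.zero_right injD)
  then have "m > 0" by (simp add: m_def)
  moreover have "m * norm v \<le> norm (A x v)" for x v
  proof (cases "norm x \<le> \<bar>R\<bar>")
    case True
    show ?thesis
    proof (cases "v = 0")
      case False
      have "m \<le> norm (A x (v /\<^sub>R norm v))"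
        using p(2)[of "(x, v /\<^sub>R norm v)"] True False by (auto simp: m_def)
      then show ?thesis
        using False by (simp add: blinfun.scaleR_right field_simps)
    qed simp
  next
    case False
    then have "norm (A x - id_blinfun) \<le> 1/2"
      using R[of x] abs_ge_self[of R] by (simp add: dist_norm)
    then have "norm ((A x - id_blinfun) v) \<le> 1/2 * norm v"
      by (meson mult_right_mono norm_blinfun norm_ge_zero order_trans)
    then have "norm (A x v - v) \<le> 1/2 * norm v"
      by (simp add: blinfun.diff_left)
    then have "1/2 * norm v \<le> norm (A x v)"
      using norm_triangle_ineq3[of "A x v" v] by linarith
    moreover have "m * norm v \<le> 1/2 * norm v"
      by (intro mult_right_mono) (auto simp: m_def)
    ultimately show ?thesis by linarith
  qed
  ultimately show ?thesis using that by blast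
qed

lemma det_pos_perturb:
  fixes S T :: "(real ^ 'd) \<Rightarrow>\<^sub>L (real ^ 'd)"
  assumes det: "det (matrix (blinfun_apply T)) > 0"
    and lower: "\<And>v. m * norm v \<le> norm (T v)" and close: "norm (S - T) < m"
  shows "det (matrix (blinfun_apply S)) > 0"
proof (rule ccontr)
  assume neg: "\<not> ?thesis"
  \<comment> \<open>Along the segment from \<open>T\<close> to \<open>S\<close> the determinant never vanishes.\<close>
  define h where "h t = det (matrix (blinfun_apply (T + t *\<^sub>R (S - T))))" for t :: real
  have "continuous_on {0..1} h"
    unfolding h_def det_def matrix_def
    by (simp add: blinfun.bilinear_simps) (intro continuous_intros)
  moreover have "h 0 > 0" "h 1 \<le> 0"
    using det neg by (auto simp: h_def)
  ultimately obtain t where t: "0 \<le> t" "t \<le> 1" "h t = 0"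
    using IVT2'[of h 1 0 0] by auto
  have "inj (blinfun_apply (T + t *\<^sub>R (S - T)))"
  proof (rule inj_of_lower_bound)
    \<comment> \<open>The perturbation along the segment costs at most \<open>norm (S - T)\<close>,
      and this much of the lower bound \<open>m\<close> remains.\<close>
    show "m - norm (S - T) > 0" using close by simp
    fix v
    have "norm (t *\<^sub>R (S - T) v) \<le> norm (S - T) * norm v"
      using mult_mono[OF t(2) norm_blinfun[of "S - T" v]] t by simp
    moreover have "norm (T v) \<le> norm (T v + t *\<^sub>R (S - T) v) + norm (t *\<^sub>R (S - T) v)"
      using norm_triangle_ineq4[of "T v + t *\<^sub>R (S - T) v" "t *\<^sub>R (S - T) v"] by simp
    ultimately show "(m - norm (S - T)) * norm v \<le> norm ((T + t *\<^sub>R (S - T)) v)"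
      using lower[of v] by (simp add: blinfun.add_left blinfun.scaleR_left left_diff_distrib)
  qed
  then show False
    using t(3) det_nz_iff_inj[OF linear_blinfun] unfolding h_def by blast
qed

section \<open>From families to Hoelder spaces\<close>

lemma bounded_linear_componentwise:
  fixes L :: "'a::euclidean_space \<Rightarrow> 'b::real_normed_vector"
  assumes "bounded_linear L"
  shows "L v = (\<Sum>b\<in>Basis. (v \<bullet> b) *\<^sub>R L b)"
proof -
  interpret bounded_linear L by fact
  show ?thesis
    by (subst euclidean_representation[of v, symmetric]) (simp add: sum scaleR)
qed

lemma holder_imp_continuous_on:
  fixes f :: "'a::real_normed_vector \<Rightarrow> 'b::real_normed_vector"
  assumes "\<beta> > 0" "\<And>x y. norm (f x - f y) \<le> C * norm (x - y) powr \<beta>"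
  shows "continuous_on UNIV f"
proof -
  have "(f \<longlongrightarrow> f x) (at x)" for x
  proof -
    have "((\<lambda>y. norm (y - x)) \<longlongrightarrow> 0) (at x)"
      by (intro tendsto_norm_zero LIM_zero tendsto_ident_at)
    then have "((\<lambda>y. norm (y - x) powr \<beta>) \<longlongrightarrow> 0) (at x)"
      using assms(1) by (auto intro!: tendsto_eq_intros)
    then have "((\<lambda>y. C * norm (y - x) powr \<beta>) \<longlongrightarrow> 0) (at x)"
      by (rule tendsto_mult_right_zero)
    then have "((\<lambda>y. f y - f x) \<longlongrightarrow> 0) (at x)"
      by (rule Lim_null_comparison[rotated]) (simp add: assms(2))
    then show ?thesis by (rule LIM_zero_cancel)
  qed
  then show ?thesis by (simp add: continuous_on_def)
qed

text \<open>The partial derivatives in the recursive definition are existentially quantified.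
  Uniqueness of the Frechet derivative, evaluated at a basis vector, identifies them with
  \<open>nderiv\<close>, and each further direction uses up one order.\<close>

lemma holder_family_nderiv:
  fixes F :: "'i \<Rightarrow> 'a::euclidean_space \<Rightarrow> 'b::real_normed_vector"
  assumes F: "holder_family I \<beta> \<sigma> n F" and lim: "\<And>i. i \<in> I \<Longrightarrow> (F i \<longlongrightarrow> 0) at_infinity"
    and bs: "set bs \<subseteq> Basis" "length bs \<le> n"
  shows "holder_family I \<beta> \<sigma> (n - length bs) (\<lambda>i x. nderiv (F i) x bs) \<and>
    (\<forall>i\<in>I. ((\<lambda>x. nderiv (F i) x bs) \<longlongrightarrow> 0) at_infinity)"
  using bs
proof (induction bs)
  case Nil
  then show ?case using F lim by simp
next
  case (Cons b bs)
  define k where "k = n - length (b # bs)"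
  have "n - length bs = Suc k" using Cons.prems by (auto simp: k_def)
  then have "holder_family I \<beta> \<sigma> (Suc k) (\<lambda>i x. nderiv (F i) x bs)" using Cons by auto
  from holder_family_SucE[OF this] obtain G where
    G: "\<And>i x. i \<in> I \<Longrightarrow> ((\<lambda>x. nderiv (F i) x bs) has_derivative (\<lambda>v. \<Sum>b\<in>Basis. (v \<bullet> b) *\<^sub>R G b i x)) (at x)"
      "\<And>b i. b \<in> Basis \<Longrightarrow> i \<in> I \<Longrightarrow> (G b i \<longlongrightarrow> 0) at_infinity"
      "\<And>b. b \<in> Basis \<Longrightarrow> holder_family I \<beta> \<sigma> k (G b)" by blast
  have b: "b \<in> Basis" using Cons.prems by simp
  have eq: "G b i = (\<lambda>x. nderiv (F i) x (b # bs))" if "i \<in> I" for i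
  proof
    fix x
    have "nderiv (F i) x (b # bs) = (\<Sum>b'\<in>Basis. (b \<bullet> b') *\<^sub>R G b' i x)"
      using frechet_derivative_at[OF G(1)[OF that], of x] by (metis nderiv.simps(2))
    also have "\<dots> = (\<Sum>b'\<in>Basis. if b' = b then G b' i x else 0)"
      using b by (intro sum.cong) (auto simp: inner_Basis)
    also have "\<dots> = G b i x" using b by simp
    finally show "G b i x = nderiv (F i) x (b # bs)" ..
  qed
  have "holder_family I \<beta> \<sigma> k (\<lambda>i x. nderiv (F i) x (b # bs))"
    by (rule holder_family_cong[OF G(3)[OF b] eq])
  moreover have "((\<lambda>x. nderiv (F i) x (b # bs)) \<longlongrightarrow> 0) at_infinity" if "i \<in> I" for i
    using G(2)[OF b that] unfolding eq[OF that] .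
  ultimately show ?case unfolding k_def by blast
qed

lemma holder_family_basis_differentiable:
  fixes F :: "'i \<Rightarrow> 'a::euclidean_space \<Rightarrow> 'b::real_normed_vector"
  assumes F: "holder_family I \<beta> \<sigma> n F" and lim: "\<And>i. i \<in> I \<Longrightarrow> (F i \<longlongrightarrow> 0) at_infinity"
    and i: "i \<in> I"
  shows "basis_differentiable n (F i)"
  unfolding basis_differentiable_def
proof (intro allI impI)
  fix bs :: "'a list" and x assume bs: "set bs \<subseteq> Basis" "length bs < n"
  then have "holder_family I \<beta> \<sigma> (Suc (n - Suc (length bs))) (\<lambda>i x. nderiv (F i) x bs)"
    using holder_family_nderiv[OF F lim, of bs] by (simp add: Suc_diff_Suc del: holder_family.simps)
  then show "(\<lambda>y. nderiv (F i) y bs) differentiable (at x)"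
    using i by (elim holder_family_SucE) (rule differentiableI)
qed

text \<open>Each of the finitely many basis lists of length up to \<open>n\<close> has its own
  constant. The sum of their absolute values serves all orders and, through the multilinear
  expansion, all unit directions.\<close>

lemma holder_family_nderiv_bounds:
  fixes F :: "'i \<Rightarrow> 'a::euclidean_space \<Rightarrow> 'b::real_normed_vector"
  assumes F: "holder_family I \<beta> \<sigma> n F" and lim: "\<And>i. i \<in> I \<Longrightarrow> (F i \<longlongrightarrow> 0) at_infinity"
    and \<sigma>: "\<And>i j. i \<in> I \<Longrightarrow> j \<in> I \<Longrightarrow> 0 \<le> \<sigma> i j"
  obtains C where "C \<ge> 0"
    "\<And>i x vs. i \<in> I \<Longrightarrow> length vs \<le> n \<Longrightarrow> unit_list vs \<Longrightarrow> norm (nderiv (F i) x vs) \<le> C"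
    "\<And>i x y vs. i \<in> I \<Longrightarrow> length vs \<le> n \<Longrightarrow> unit_list vs \<Longrightarrow>
       norm (nderiv (F i) x vs - nderiv (F i) y vs) \<le> C * norm (x - y) powr \<beta>"
    "\<And>i j x vs. i \<in> I \<Longrightarrow> j \<in> I \<Longrightarrow> length vs \<le> n \<Longrightarrow> unit_list vs \<Longrightarrow>
       norm (nderiv (F i) x vs - nderiv (F j) x vs) \<le> C * \<sigma> i j"
proof -
  define L where "L = {bs :: 'a list. set bs \<subseteq> Basis \<and> length bs \<le> n}"
  have finL: "finite L" unfolding L_def by (rule finite_lists_length_le) simp
  have "\<forall>bs\<in>L. \<exists>C. (\<forall>i\<in>I. \<forall>x. norm (nderiv (F i) x bs) \<le> C) \<and>
      (\<forall>i\<in>I. \<forall>x y. norm (nderiv (F i) x bs - nderiv (F i) y bs) \<le> C * norm (x - y) powr \<beta>) \<and>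
      (\<forall>i\<in>I. \<forall>j\<in>I. \<forall>x. norm (nderiv (F i) x bs - nderiv (F j) x bs) \<le> C * \<sigma> i j)"
  proof
    fix bs assume "bs \<in> L"
    then have "holder_family0 I \<beta> \<sigma> (\<lambda>i x. nderiv (F i) x bs)"
      using holder_family_nderiv[OF F lim] holder_family_imp_holder_family0 unfolding L_def by blast
    then show "\<exists>C. (\<forall>i\<in>I. \<forall>x. norm (nderiv (F i) x bs) \<le> C) \<and>
      (\<forall>i\<in>I. \<forall>x y. norm (nderiv (F i) x bs - nderiv (F i) y bs) \<le> C * norm (x - y) powr \<beta>) \<and>
      (\<forall>i\<in>I. \<forall>j\<in>I. \<forall>x. norm (nderiv (F i) x bs - nderiv (F j) x bs) \<le> C * \<sigma> i j)"
      unfolding holder_family0_def by (rule conjunct1)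
  qed
  from bchoice[OF this] obtain c where
    c: "\<forall>bs\<in>L. (\<forall>i\<in>I. \<forall>x. norm (nderiv (F i) x bs) \<le> c bs) \<and>
      (\<forall>i\<in>I. \<forall>x y. norm (nderiv (F i) x bs - nderiv (F i) y bs) \<le> c bs * norm (x - y) powr \<beta>) \<and>
      (\<forall>i\<in>I. \<forall>j\<in>I. \<forall>x. norm (nderiv (F i) x bs - nderiv (F j) x bs) \<le> c bs * \<sigma> i j)" ..
  define C where "C = (\<Sum>bs\<in>L. \<bar>c bs\<bar>)"
  have sub: "blists (length vs) \<subseteq> L" if "length vs \<le> n" for vs :: "'a list"
    using that by (auto simp: blists_def L_def)
  \<comment> \<open>Common core of the three estimates, with \<open>t\<close> equal to 1, to |x -
    y|^\<beta> and to \<open>\<sigma> i j\<close>.\<close>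
  have sum_le: "(\<Sum>bs\<in>blists (length vs). a bs) \<le> C * t"
    if "length vs \<le> n" "\<And>bs. bs \<in> L \<Longrightarrow> a bs \<le> c bs * t" "t \<ge> 0" for vs :: "'a list" and a t
  proof -
    have "(\<Sum>bs\<in>blists (length vs). a bs) \<le> (\<Sum>bs\<in>blists (length vs). \<bar>c bs\<bar> * t)"
    proof (rule sum_mono)
      fix bs :: "'a list" assume "bs \<in> blists (length vs)"
      then have "a bs \<le> c bs * t" using that(2) sub[OF that(1)] by auto
      also have "\<dots> \<le> \<bar>c bs\<bar> * t" using that(3) by (intro mult_right_mono) auto
      finally show "a bs \<le> \<bar>c bs\<bar> * t" .
    qed
    also have "\<dots> \<le> (\<Sum>bs\<in>L. \<bar>c bs\<bar> * t)"
      using that(3) by (intro sum_mono2[OF finL sub[OF that(1)]]) simp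
    finally show ?thesis by (simp add: C_def sum_distrib_right)
  qed
  have bd: "basis_differentiable n (F i)" if "i \<in> I" for i
    by (rule holder_family_basis_differentiable[OF F lim that])
  show ?thesis
  proof (rule that[of C])
    show "C \<ge> 0" unfolding C_def by (intro sum_nonneg) simp
    show "norm (nderiv (F i) x vs) \<le> C" if "i \<in> I" "length vs \<le> n" "unit_list vs" for i x vs
      using order_trans[OF norm_nderiv_le_sum[OF bd[OF that(1)] that(2,3), of x]
        sum_le[OF that(2), of "\<lambda>bs. norm (nderiv (F i) x bs)" 1]] c that(1) by simp
    show "norm (nderiv (F i) x vs - nderiv (F i) y vs) \<le> C * norm (x - y) powr \<beta>"
      if "i \<in> I" "length vs \<le> n" "unit_list vs" for i x y vs
      by (rule order_trans[OF norm_nderiv_diff_le_sum[OF bd[OF that(1)] bd[OF that(1)] that(2,3)] sum_le[OF that(2)]])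
        (use c that(1) in auto)
    show "norm (nderiv (F i) x vs - nderiv (F j) x vs) \<le> C * \<sigma> i j"
      if "i \<in> I" "j \<in> I" "length vs \<le> n" "unit_list vs" for i j x vs
      by (rule order_trans[OF norm_nderiv_diff_le_sum[OF bd[OF that(1)] bd[OF that(2)] that(3,4)] sum_le[OF that(3)]])
        (use c that(1,2) \<sigma> in auto)
  qed
qed

lemma holder_family_imp_C0:
  fixes F :: "'i \<Rightarrow> 'a::euclidean_space \<Rightarrow> 'b::real_normed_vector"
  assumes F: "holder_family I \<beta> \<sigma> n F" and lim: "\<And>i. i \<in> I \<Longrightarrow> (F i \<longlongrightarrow> 0) at_infinity"
    and \<sigma>: "\<And>i j. i \<in> I \<Longrightarrow> j \<in> I \<Longrightarrow> 0 \<le> \<sigma> i j" and "\<beta> > 0" and i: "i \<in> I"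
  shows "F i \<in> C0 n \<beta>"
proof -
  obtain C where C: "C \<ge> 0"
    "\<And>i x vs. i \<in> I \<Longrightarrow> length vs \<le> n \<Longrightarrow> unit_list vs \<Longrightarrow> norm (nderiv (F i) x vs) \<le> C"
    "\<And>i x y vs. i \<in> I \<Longrightarrow> length vs \<le> n \<Longrightarrow> unit_list vs \<Longrightarrow>
       norm (nderiv (F i) x vs - nderiv (F i) y vs) \<le> C * norm (x - y) powr \<beta>"
    using holder_family_nderiv_bounds[OF F lim \<sigma>] by metis
  show ?thesis
  proof (rule C0I[OF holder_family_basis_differentiable[OF F lim i]])
    fix bs :: "'a list" assume bs: "set bs \<subseteq> Basis" "length bs \<le> n"
    show "norm (nderiv (F i) x bs) \<le> C" for x
      by (rule C(2)[OF i bs(2) unit_list_Basis[OF bs(1)]])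
    show "continuous_on UNIV (\<lambda>x. nderiv (F i) x bs)"
      by (rule holder_imp_continuous_on[OF \<open>\<beta> > 0\<close> C(3)[OF i bs(2) unit_list_Basis[OF bs(1)]]])
    show "((\<lambda>x. nderiv (F i) x bs) \<longlongrightarrow> 0) at_infinity"
      using holder_family_nderiv[OF F lim bs] i by blast
  next
    fix bs :: "'a list" and x y assume "set bs \<subseteq> Basis" "length bs = n"
    then show "norm (nderiv (F i) x bs - nderiv (F i) y bs) \<le> C * norm (x - y) powr \<beta>"
      by (intro C(3)[OF i] unit_list_Basis) auto
  qed
qed

section \<open>Differentials as operator-valued functions of the displacement\<close>

text \<open>The differential of \<open>Id + \<phi>\<close>.\<close>

definition dPhi :: "('a::euclidean_space \<Rightarrow> 'a) \<Rightarrow> 'a \<Rightarrow> ('a \<Rightarrow>\<^sub>L 'a)" where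
  "dPhi \<phi> x = id_blinfun + (\<Sum>b\<in>Basis. blinfun_scaleR_left (nderiv \<phi> x [b]) o\<^sub>L blinfun_inner_left b)"

text \<open>\<open>dPhi\<close> is the identity plus rank-one operators, each linear and continuous
  in one partial derivative. Limits, continuity and family bounds therefore pass from partial
  derivatives to the differential by the rules for bounded linear maps.\<close>

lemma bounded_linear_rank_one: "bounded_linear (\<lambda>w. blinfun_scaleR_left w o\<^sub>L blinfun_inner_left b)"
  by (intro bounded_linear_compose[OF bounded_bilinear.bounded_linear_left[OF bounded_bilinear_blinfun_compose]]
      bounded_linear_blinfun_scaleR_left)

lemma bounded_linear_nderiv_Cons:
  assumes "basis_differentiable n f" and "length vs < n"
  shows "bounded_linear (\<lambda>v. nderiv f x (v # vs))"
  by (rule has_derivative_bounded_linear[OF has_derivative_nderiv[OF assms]])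

lemma norm_nderiv_Cons_le:
  assumes f: "basis_differentiable n f" and "length vs < n"
    and bound: "\<And>v. norm v \<le> 1 \<Longrightarrow> norm (nderiv f x (v # vs)) \<le> C"
  shows "norm (nderiv f x (v # vs)) \<le> C * norm v"
proof (cases "v = 0")
  case False
  interpret bounded_linear "\<lambda>v. nderiv f x (v # vs)"
    by (rule bounded_linear_nderiv_Cons[OF assms(1,2)])
  have "norm (nderiv f x ((v /\<^sub>R norm v) # vs)) \<le> C"
    by (rule bound) (use False in simp)
  then show ?thesis
    using False unfolding scaleR by (simp add: field_simps del: nderiv.simps)
next
  case True
  then show ?thesis
    using bounded_linear.linear[OF bounded_linear_nderiv_Cons[OF assms(1,2)], of x] linear_0
    by (fastforce simp del: nderiv.simps)
qed

context
  fixes n :: nat and \<beta> :: real and \<phi> :: "'a::euclidean_space \<Rightarrow> 'a"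
  assumes n: "1 \<le> n" and \<phi>: "\<phi> \<in> C0 n \<beta>"
begin

lemma dPhi_apply: "dPhi \<phi> x v = v + nderiv \<phi> x [v]"
proof -
  have "nderiv \<phi> x [v] = (\<Sum>b\<in>Basis. (v \<bullet> b) *\<^sub>R nderiv \<phi> x [b])"
    using n by (intro bounded_linear_componentwise bounded_linear_nderiv_Cons[OF C0_basis_differentiable[OF \<phi>]]) auto
  then show ?thesis
    by (simp add: dPhi_def blinfun.add_left blinfun.sum_left del: nderiv.simps)
qed

lemma has_derivative_dPhi: "((\<lambda>x. x + \<phi> x) has_derivative blinfun_apply (dPhi \<phi> x)) (at x)"
  using has_derivative_add[OF has_derivative_ident has_derivative_nderiv[OF C0_basis_differentiable[OF \<phi>], of "[]" x]] n
  by (simp add: dPhi_apply[abs_def] del: nderiv.simps(2))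

lemma tendsto_dPhi: "(dPhi \<phi> \<longlongrightarrow> id_blinfun) at_infinity"
proof -
  have "(dPhi \<phi> \<longlongrightarrow> id_blinfun + (\<Sum>b\<in>Basis. blinfun_scaleR_left 0 o\<^sub>L blinfun_inner_left (b::'a))) at_infinity"
    unfolding dPhi_def[abs_def]
    by (intro tendsto_intros bounded_linear.tendsto[OF bounded_linear_rank_one] C0_tendsto[OF \<phi>])
      (use n in \<open>auto simp: unit_list_def\<close>)
  then show ?thesis
    by (simp add: linear_simps(3)[OF bounded_linear_rank_one])
qed

lemma continuous_on_dPhi: "continuous_on UNIV (dPhi \<phi>)"
  unfolding dPhi_def[abs_def]
  by (intro continuous_intros bounded_linear.continuous_on[OF bounded_linear_rank_one] C0_continuous[OF \<phi>])
    (use n in auto)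

lemma norm_le_holder_norm: "norm (\<phi> x) \<le> holder_norm n \<gamma> \<phi>"
  using norm_nderiv_le_holder_norm[OF \<phi>, of "[]" x] by simp

end

lemma Diffeos_minus_Id_iff:
  fixes \<phi> :: "real ^ 'd \<Rightarrow> real ^ 'd"
  assumes "1 \<le> n"
  shows "\<phi> \<in> Diffeos_minus_Id n \<beta> \<longleftrightarrow>
    \<phi> \<in> C0 n \<beta> \<and> (\<forall>x. det (matrix (blinfun_apply (dPhi \<phi> x))) > 0)"
proof -
  have eq: "frechet_derivative (\<lambda>x. x + f x) (at x) = blinfun_apply (dPhi f x)"
    if "f \<in> C0 n \<beta>" for f :: "real ^ 'd \<Rightarrow> real ^ 'd" and x
    using frechet_derivative_at[OF has_derivative_dPhi[OF assms that]] ..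
  show ?thesis
  proof
    assume "\<phi> \<in> Diffeos_minus_Id n \<beta>"
    then show "\<phi> \<in> C0 n \<beta> \<and> (\<forall>x. det (matrix (blinfun_apply (dPhi \<phi> x))) > 0)"
      by (auto simp: Diffeos_minus_Id_def Diffeos_def eq)
  next
    assume "\<phi> \<in> C0 n \<beta> \<and> (\<forall>x. det (matrix (blinfun_apply (dPhi \<phi> x))) > 0)"
    then have "(\<lambda>x. x + \<phi> x) \<in> Diffeos n \<beta>"
      by (auto simp: Diffeos_def eq)
    then show "\<phi> \<in> Diffeos_minus_Id n \<beta>"
      unfolding Diffeos_minus_Id_def by (rule image_eqI[rotated]) simp
  qed
qed

section \<open>Uniform bounds on balls around \<open>\<phi>\<^sub>0\<close>\<close>

lemma C0_ball_bounds:
  fixes \<phi>\<^sub>0 :: "'a::euclidean_space \<Rightarrow> 'b::real_normed_vector"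
  assumes \<phi>\<^sub>0: "\<phi>\<^sub>0 \<in> C0 n \<beta>" and \<phi>: "\<phi> \<in> C0_ball n \<beta> \<phi>\<^sub>0 \<delta>" and vs: "length vs \<le> n" "unit_list vs"
  shows "norm (nderiv \<phi> x vs - nderiv \<phi>\<^sub>0 x vs) < \<delta>"
    and "norm (nderiv \<phi> x vs) \<le> holder_norm n \<beta> \<phi>\<^sub>0 + \<delta>"
    and "length vs = n \<Longrightarrow>
      norm (nderiv \<phi> x vs - nderiv \<phi> y vs) \<le> (holder_norm n \<beta> \<phi>\<^sub>0 + \<delta>) * norm (x - y) powr \<beta>"
proof -
  have C0: "\<phi> \<in> C0 n \<beta>" and less: "holder_norm n \<beta> (\<lambda>x. \<phi> x - \<phi>\<^sub>0 x) < \<delta>"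
    using \<phi> by (auto simp: C0_ball_def)
  note d = C0_diff[OF C0 \<phi>\<^sub>0]
  note eq = nderiv_diff[OF C0_basis_differentiable[OF C0] C0_basis_differentiable[OF \<phi>\<^sub>0] vs(1)]
  show *: "norm (nderiv \<phi> x vs - nderiv \<phi>\<^sub>0 x vs) < \<delta>"
    using norm_nderiv_le_holder_norm[OF d vs, of x \<beta>] less unfolding eq by linarith
  show "norm (nderiv \<phi> x vs) \<le> holder_norm n \<beta> \<phi>\<^sub>0 + \<delta>"
    using * norm_nderiv_le_holder_norm[OF \<phi>\<^sub>0 vs, of x \<beta>]
      norm_triangle_ineq[of "nderiv \<phi>\<^sub>0 x vs" "nderiv \<phi> x vs - nderiv \<phi>\<^sub>0 x vs"] by simp
  assume len: "length vs = n"
  let ?u = "nderiv \<phi>\<^sub>0 x vs - nderiv \<phi>\<^sub>0 y vs"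
    and ?w = "(nderiv \<phi> x vs - nderiv \<phi>\<^sub>0 x vs) - (nderiv \<phi> y vs - nderiv \<phi>\<^sub>0 y vs)"
  have "norm ?w \<le> holder_norm n \<beta> (\<lambda>x. \<phi> x - \<phi>\<^sub>0 x) * norm (x - y) powr \<beta>"
    using norm_nderiv_diff_le_holder_norm[OF d len vs(2), of x y] unfolding eq .
  also have "\<dots> \<le> \<delta> * norm (x - y) powr \<beta>"
    using less by (intro mult_right_mono) auto
  finally have "norm ?w \<le> \<delta> * norm (x - y) powr \<beta>" .
  moreover have "norm ?u \<le> holder_norm n \<beta> \<phi>\<^sub>0 * norm (x - y) powr \<beta>"
    by (rule norm_nderiv_diff_le_holder_norm[OF \<phi>\<^sub>0 len vs(2)])
  moreover have "norm (nderiv \<phi> x vs - nderiv \<phi> y vs) \<le> norm ?u + norm ?w"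
    using norm_triangle_ineq[of ?u ?w] by (simp add: algebra_simps)
  ultimately show "norm (nderiv \<phi> x vs - nderiv \<phi> y vs) \<le> (holder_norm n \<beta> \<phi>\<^sub>0 + \<delta>) * norm (x - y) powr \<beta>"
    by (simp add: distrib_right)
qed

text \<open>Meant for derivatives below the top order, which are bounded and, by the mean value
  theorem, Lipschitz. The case \<beta> = 1 is separate because the interpolation asks for strictly
  ordered exponents.\<close>

lemma lipschitz_imp_holder:
  fixes d N t \<beta> :: real
  assumes "0 \<le> d" "d \<le> N * t" "d \<le> N" "0 \<le> t" "0 < \<beta>" "\<beta> \<le> 1"
  shows "d \<le> N * t powr \<beta>"
proof (cases "\<beta> = 1")
  case False
  have "d \<le> N * t powr \<beta> * 1 powr (1 - \<beta>)"
    using assms False by (intro powr_interpolate) auto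
  then show ?thesis by simp
qed (use assms in auto)

text \<open>Turns linear dependence on the index into the modulus r^\<beta>: for quantities bounded
  by \<open>R\<close>, the remaining power 1 - \<beta> is absorbed into a constant.\<close>

lemma le_powr_of_bounded:
  fixes d R r \<beta> :: real
  assumes "0 \<le> d" "d \<le> R" "d \<le> r" "0 < \<beta>" "\<beta> \<le> 1"
  shows "d \<le> R powr (1 - \<beta>) * r powr \<beta>"
proof (cases "d = 0")
  case False
  then have "d = d powr (1 - \<beta>) * d powr \<beta>"
    using assms by (simp flip: powr_add)
  also have "\<dots> \<le> R powr (1 - \<beta>) * r powr \<beta>"
    using assms by (intro mult_mono powr_mono2) auto
  finally show ?thesis .
qed simp

definition ball_sigma ::
  "nat \<Rightarrow> real \<Rightarrow> real \<Rightarrow> ('a::euclidean_space \<Rightarrow> 'b::real_normed_vector) \<Rightarrow> ('a \<Rightarrow> 'b) \<Rightarrow> real" where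
  "ball_sigma n \<alpha> \<beta> \<phi>\<^sub>1 \<phi>\<^sub>2 = holder_norm n \<alpha> (\<lambda>x. \<phi>\<^sub>1 x - \<phi>\<^sub>2 x) powr \<beta>"

text \<open>At order \<open>n\<close> the Hoelder bound is part of the norm; below it, the next
  derivative is bounded, which gives a Lipschitz bound. Derivatives of two members of the ball
  differ by at most 2\<delta>, whence the factor (2\<delta>)^(1-\<beta>) in the dependence on the
  index.\<close>

lemma holder_family0_C0_ball:
  fixes \<phi>\<^sub>0 :: "'a::euclidean_space \<Rightarrow> 'b::real_normed_vector"
  assumes \<beta>: "0 < \<beta>" "\<beta> \<le> 1" and \<phi>\<^sub>0: "\<phi>\<^sub>0 \<in> C0 n \<beta>"
    and bs: "set bs \<subseteq> Basis" "length bs \<le> n"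
  shows "holder_family0 (C0_ball n \<beta> \<phi>\<^sub>0 \<delta>) \<beta> (ball_sigma n \<alpha> \<beta>) (\<lambda>\<phi> x. nderiv \<phi> x bs)"
proof (rule holder_family0I)
  let ?I = "C0_ball n \<beta> \<phi>\<^sub>0 \<delta>" and ?N = "holder_norm n \<beta> \<phi>\<^sub>0 + \<delta>"
  have C0: "\<phi> \<in> C0 n \<beta>" if "\<phi> \<in> ?I" for \<phi>
    using that by (simp add: C0_ball_def)
  note u = unit_list_Basis[OF bs(1)]
  show "norm (nderiv \<phi> x bs) \<le> ?N" if "\<phi> \<in> ?I" for \<phi> x
    by (rule C0_ball_bounds(2)[OF \<phi>\<^sub>0 that bs(2) u])
  show "norm (nderiv \<phi> x bs - nderiv \<phi> y bs) \<le> 2 * ?N * norm (x - y) powr \<beta>" if \<phi>: "\<phi> \<in> ?I" for \<phi> x y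
  proof -
    have bound: "norm (nderiv \<phi> x bs) \<le> ?N" for x
      by (rule C0_ball_bounds(2)[OF \<phi>\<^sub>0 \<phi> bs(2) u])
    then have "?N \<ge> 0" using norm_ge_zero order_trans by blast
    show ?thesis
    proof (cases "length bs = n")
      case True
      have "norm (nderiv \<phi> x bs - nderiv \<phi> y bs) \<le> ?N * norm (x - y) powr \<beta>"
        by (rule C0_ball_bounds(3)[OF \<phi>\<^sub>0 \<phi> bs(2) u True])
      also have "\<dots> \<le> 2 * ?N * norm (x - y) powr \<beta>"
        using \<open>?N \<ge> 0\<close> by (intro mult_right_mono) auto
      finally show ?thesis .
    next
      case False
      then have len: "length bs < n" using bs by simp
      note bd = C0_basis_differentiable[OF C0[OF \<phi>]]
      have "norm (nderiv \<phi> x bs - nderiv \<phi> y bs) \<le> ?N * norm (x - y)"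
      proof (rule differentiable_bound[OF convex_UNIV _ _ UNIV_I UNIV_I])
        show "((\<lambda>x. nderiv \<phi> x bs) has_derivative (\<lambda>v. nderiv \<phi> z (v # bs))) (at z)" for z
          by (rule has_derivative_nderiv[OF bd len])
        show "onorm (\<lambda>v. nderiv \<phi> z (v # bs)) \<le> ?N" for z
        proof (rule onorm_bound[OF \<open>?N \<ge> 0\<close>])
          show "norm (nderiv \<phi> z (v # bs)) \<le> ?N * norm v" for v
            by (rule norm_nderiv_Cons_le[OF bd len], rule C0_ball_bounds(2)[OF \<phi>\<^sub>0 \<phi>]) (use len u in auto)
        qed
      qed
      moreover have "?N * norm (x - y) \<le> 2 * ?N * norm (x - y)"
        using \<open>?N \<ge> 0\<close> by (intro mult_right_mono) auto
      moreover have "norm (nderiv \<phi> x bs - nderiv \<phi> y bs) \<le> 2 * ?N"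
        unfolding mult_2 by (rule order_trans[OF norm_triangle_ineq4 add_mono[OF bound bound]])
      ultimately show ?thesis
        by (intro lipschitz_imp_holder \<beta>) auto
    qed
  qed
  show "norm (nderiv \<phi>\<^sub>1 x bs - nderiv \<phi>\<^sub>2 x bs) \<le> (2 * \<delta>) powr (1 - \<beta>) * ball_sigma n \<alpha> \<beta> \<phi>\<^sub>1 \<phi>\<^sub>2"
    if \<phi>: "\<phi>\<^sub>1 \<in> ?I" "\<phi>\<^sub>2 \<in> ?I" for \<phi>\<^sub>1 \<phi>\<^sub>2 x
    unfolding ball_sigma_def
  proof (rule le_powr_of_bounded[OF norm_ge_zero _ _ \<beta>])
    show "norm (nderiv \<phi>\<^sub>1 x bs - nderiv \<phi>\<^sub>2 x bs) \<le> 2 * \<delta>"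
      using C0_ball_bounds(1)[OF \<phi>\<^sub>0 \<phi>(1) bs(2) u, of x] C0_ball_bounds(1)[OF \<phi>\<^sub>0 \<phi>(2) bs(2) u, of x]
        norm_triangle_ineq4[of "nderiv \<phi>\<^sub>1 x bs - nderiv \<phi>\<^sub>0 x bs" "nderiv \<phi>\<^sub>2 x bs - nderiv \<phi>\<^sub>0 x bs"]
      by simp
    show "norm (nderiv \<phi>\<^sub>1 x bs - nderiv \<phi>\<^sub>2 x bs) \<le> holder_norm n \<alpha> (\<lambda>x. \<phi>\<^sub>1 x - \<phi>\<^sub>2 x)"
      using norm_nderiv_le_holder_norm[OF C0_diff[OF C0[OF \<phi>(1)] C0[OF \<phi>(2)]] bs(2) u, of x \<alpha>]
      by (simp add: nderiv_diff[OF C0_basis_differentiable[OF C0[OF \<phi>(1)]] C0_basis_differentiable[OF C0[OF \<phi>(2)]] bs(2)])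
  qed
  show "\<exists>L. ((\<lambda>x. nderiv \<phi> x bs) \<longlongrightarrow> L) at_infinity" if "\<phi> \<in> ?I" for \<phi>
    using C0_tendsto[OF C0[OF that] bs(2) u] by blast
qed (simp add: ball_sigma_def)

lemma holder_family_C0_ball:
  fixes \<phi>\<^sub>0 :: "'a::euclidean_space \<Rightarrow> 'b::real_normed_vector"
  assumes \<beta>: "0 < \<beta>" "\<beta> \<le> 1" and \<phi>\<^sub>0: "\<phi>\<^sub>0 \<in> C0 n \<beta>"
    and bs: "set bs \<subseteq> Basis" "length bs + k = n"
  shows "holder_family (C0_ball n \<beta> \<phi>\<^sub>0 \<delta>) \<beta> (ball_sigma n \<alpha> \<beta>) k (\<lambda>\<phi> x. nderiv \<phi> x bs)"
  using bs
proof (induction k arbitrary: bs)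
  case 0
  then show ?case using holder_family0_C0_ball[OF assms(1-3)] by simp
next
  case (Suc k)
  show ?case
  proof (rule holder_family_SucI[where G = "\<lambda>b \<phi> x. nderiv \<phi> x (b # bs)"])
    show "holder_family0 (C0_ball n \<beta> \<phi>\<^sub>0 \<delta>) \<beta> (ball_sigma n \<alpha> \<beta>) (\<lambda>\<phi> x. nderiv \<phi> x bs)"
      using Suc.prems by (intro holder_family0_C0_ball[OF assms(1-3)]) auto
    have len: "length bs < n" using Suc.prems by simp
    show "((\<lambda>x. nderiv \<phi> x bs) has_derivative (\<lambda>v. \<Sum>b\<in>Basis. (v \<bullet> b) *\<^sub>R nderiv \<phi> x (b # bs))) (at x)"
      if "\<phi> \<in> C0_ball n \<beta> \<phi>\<^sub>0 \<delta>" for \<phi> x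
    proof -
      have bd: "basis_differentiable n \<phi>"
        using that by (auto simp: C0_ball_def intro: C0_basis_differentiable)
      show ?thesis
        using has_derivative_nderiv[OF bd len, of x]
        unfolding bounded_linear_componentwise[OF bounded_linear_nderiv_Cons[OF bd len], symmetric] .
    qed
    show "((\<lambda>x. nderiv \<phi> x (b # bs)) \<longlongrightarrow> 0) at_infinity"
      if "b \<in> Basis" "\<phi> \<in> C0_ball n \<beta> \<phi>\<^sub>0 \<delta>" for b \<phi>
      using that Suc.prems unit_list_Basis[of "b # bs"]
      by (intro C0_tendsto[of _ n \<beta>]) (auto simp: C0_ball_def)
    show "holder_family (C0_ball n \<beta> \<phi>\<^sub>0 \<delta>) \<beta> (ball_sigma n \<alpha> \<beta>) k (\<lambda>\<phi> x. nderiv \<phi> x (b # bs))"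
      if "b \<in> Basis" for b
      using that Suc.prems by (intro Suc.IH) auto
  qed
qed

lemma holder_family_dPhi:
  fixes \<phi>\<^sub>0 :: "'a::euclidean_space \<Rightarrow> 'a"
  assumes \<beta>: "0 < \<beta>" "\<beta> \<le> 1" and n: "1 \<le> n" and \<phi>\<^sub>0: "\<phi>\<^sub>0 \<in> C0 n \<beta>"
  shows "holder_family (C0_ball n \<beta> \<phi>\<^sub>0 \<delta>) \<beta> (ball_sigma n \<alpha> \<beta>) (n - 1) dPhi"
proof -
  have \<sigma>: "0 \<le> ball_sigma n \<alpha> \<beta> \<phi>\<^sub>1 \<phi>\<^sub>2" for \<phi>\<^sub>1 \<phi>\<^sub>2 :: "'a \<Rightarrow> 'a"
    by (simp add: ball_sigma_def)
  have "holder_family (C0_ball n \<beta> \<phi>\<^sub>0 \<delta>) \<beta> (ball_sigma n \<alpha> \<beta>) (n - 1) (\<lambda>\<phi> x. nderiv \<phi> x [b])"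
    if "b \<in> Basis" for b
    using that n by (intro holder_family_C0_ball[OF \<beta> \<phi>\<^sub>0]) auto
  then have "holder_family (C0_ball n \<beta> \<phi>\<^sub>0 \<delta>) \<beta> (ball_sigma n \<alpha> \<beta>) (n - 1) (\<lambda>\<phi> x. id_blinfun +
      (\<Sum>b\<in>Basis. blinfun_scaleR_left (nderiv \<phi> x [b]) o\<^sub>L blinfun_inner_left b))"
    by (intro holder_family_add[OF \<sigma>] holder_family_const[OF \<sigma>] holder_family_sum[OF \<sigma>] holder_family_linear[OF \<sigma> bounded_linear_rank_one])
  then show ?thesis
    by (simp add: dPhi_def[abs_def] del: nderiv.simps)
qed

lemma norm_dPhi_diff_le:
  fixes \<phi>\<^sub>0 :: "'a::euclidean_space \<Rightarrow> 'a"
  assumes n: "1 \<le> n" and \<phi>\<^sub>0: "\<phi>\<^sub>0 \<in> C0 n \<beta>" and \<phi>: "\<phi> \<in> C0_ball n \<beta> \<phi>\<^sub>0 \<delta>"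
  shows "norm (dPhi \<phi> x - dPhi \<phi>\<^sub>0 x) \<le> \<delta>"
proof -
  have C0: "\<phi> \<in> C0 n \<beta>" using \<phi> by (simp add: C0_ball_def)
  note bd = C0_basis_differentiable[OF C0] C0_basis_differentiable[OF \<phi>\<^sub>0]
  have eq: "nderiv (\<lambda>x. \<phi> x - \<phi>\<^sub>0 x) x [v] = nderiv \<phi> x [v] - nderiv \<phi>\<^sub>0 x [v]" for v
    by (rule nderiv_diff[OF bd]) (use n in simp)
  have less: "norm (nderiv \<phi> x [v] - nderiv \<phi>\<^sub>0 x [v]) < \<delta>" if "norm v \<le> 1" for v
    by (rule C0_ball_bounds(1)[OF \<phi>\<^sub>0 \<phi>]) (use n that in auto)
  have "\<delta> \<ge> 0" using less[of 0] norm_ge_zero less_imp_le order_trans norm_zero by (smt (verit))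
  then show ?thesis
  proof (rule norm_blinfun_bound)
    fix v
    have "norm (nderiv (\<lambda>x. \<phi> x - \<phi>\<^sub>0 x) x [v]) \<le> \<delta> * norm v"
    proof (rule norm_nderiv_Cons_le[OF basis_differentiable_diff[OF bd]])
      show "norm (nderiv (\<lambda>x. \<phi> x - \<phi>\<^sub>0 x) x [v]) \<le> \<delta>" if "norm v \<le> 1" for v
        unfolding eq using less[OF that] by (rule less_imp_le)
    qed (use n in simp)
    then show "norm ((dPhi \<phi> x - dPhi \<phi>\<^sub>0 x) v) \<le> \<delta> * norm v"
      unfolding eq by (simp add: blinfun.diff_left dPhi_apply[OF n C0] dPhi_apply[OF n \<phi>\<^sub>0] del: nderiv.simps)
  qed
qed

section \<open>Local Hoelder estimate for the inversion map\<close>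

text \<open>Everything rests on one lower bound \<open>m\<close> for the whole ball: it yields the
  differentials \<open>B\<close> of the inverse maps, their bound and the Lipschitz constant
  \<open>1 / m\<close>. The third conclusion is retained to determine the sign of the determinant of
  the inverse.\<close>

lemma holder_family_inv_c:
  fixes \<phi>\<^sub>0 :: "'a::euclidean_space \<Rightarrow> 'a" and n :: nat and \<alpha> \<beta> :: real
  defines "\<sigma> \<equiv> ball_sigma n \<alpha> \<beta>"
  assumes \<beta>: "0 < \<beta>" "\<beta> \<le> 1" and n: "1 \<le> n" and \<phi>\<^sub>0: "\<phi>\<^sub>0 \<in> C0 n \<beta>" and m: "m > 0"
    and lower: "\<And>\<phi> x v. \<phi> \<in> C0_ball n \<beta> \<phi>\<^sub>0 \<delta> \<Longrightarrow> m * norm v \<le> norm (dPhi \<phi> x v)"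
  shows "holder_family (C0_ball n \<beta> \<phi>\<^sub>0 \<delta>) \<beta> \<sigma> n inv_c"
    and "\<And>\<phi>. \<phi> \<in> C0_ball n \<beta> \<phi>\<^sub>0 \<delta> \<Longrightarrow> (inv_c \<phi> \<longlongrightarrow> 0) at_infinity"
    and "\<And>\<phi> y. \<phi> \<in> C0_ball n \<beta> \<phi>\<^sub>0 \<delta> \<Longrightarrow>
      \<exists>B. (inv (\<lambda>x. x + \<phi> x) has_derivative blinfun_apply B) (at y) \<and>
          dPhi \<phi> (inv (\<lambda>x. x + \<phi> x) y) o\<^sub>L B = id_blinfun"
proof -
  let ?I = "C0_ball n \<beta> \<phi>\<^sub>0 \<delta>"
  define \<Psi> :: "('a \<Rightarrow> 'a) \<Rightarrow> 'a \<Rightarrow> 'a" where "\<Psi> \<phi> = inv (\<lambda>x. x + \<phi> x)" for \<phi>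
  have \<sigma>: "0 \<le> \<sigma> i j" for i j
    by (simp add: \<sigma>_def ball_sigma_def)
  have C0: "\<phi> \<in> C0 n \<beta>" if "\<phi> \<in> ?I" for \<phi>
    using that by (simp add: C0_ball_def)
  have "\<forall>\<phi>\<in>?I. \<exists>B. bij (\<lambda>x. x + \<phi> x) \<and> (\<forall>y. (\<Psi> \<phi> has_derivative blinfun_apply (B y)) (at y)) \<and>
      (\<forall>y. B y o\<^sub>L dPhi \<phi> (\<Psi> \<phi> y) = id_blinfun) \<and> (\<forall>y. dPhi \<phi> (\<Psi> \<phi> y) o\<^sub>L B y = id_blinfun) \<and>
      (\<forall>y. norm (B y) \<le> 1 / m)"
  proof
    fix \<phi> assume \<phi>: "\<phi> \<in> ?I"
    show "\<exists>B. bij (\<lambda>x. x + \<phi> x) \<and> (\<forall>y. (\<Psi> \<phi> has_derivative blinfun_apply (B y)) (at y)) \<and>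
      (\<forall>y. B y o\<^sub>L dPhi \<phi> (\<Psi> \<phi> y) = id_blinfun) \<and> (\<forall>y. dPhi \<phi> (\<Psi> \<phi> y) o\<^sub>L B y = id_blinfun) \<and>
      (\<forall>y. norm (B y) \<le> 1 / m)"
    proof (rule global_inverse_derivative[where f = "\<lambda>x. x + \<phi> x" and A = "dPhi \<phi>" and m = m and C = "holder_norm n \<beta> \<phi>"])
      show "norm (x + \<phi> x - x) \<le> holder_norm n \<beta> \<phi>" for x
        using norm_le_holder_norm[OF n C0[OF \<phi>]] by simp
    next
      fix B assume "bij (\<lambda>x. x + \<phi> x)"
        "\<And>y. (inv (\<lambda>x. x + \<phi> x) has_derivative blinfun_apply (B y)) (at y)"
        "\<And>y. B y o\<^sub>L dPhi \<phi> (inv (\<lambda>x. x + \<phi> x) y) = id_blinfun"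
        "\<And>y. dPhi \<phi> (inv (\<lambda>x. x + \<phi> x) y) o\<^sub>L B y = id_blinfun" "\<And>y. norm (B y) \<le> 1 / m"
      then show ?thesis
        unfolding \<Psi>_def by (intro exI[of _ B]) simp
    qed (fact has_derivative_dPhi[OF n C0[OF \<phi>]] continuous_on_dPhi[OF n C0[OF \<phi>]] m lower[OF \<phi>]
        tendsto_dPhi[OF n C0[OF \<phi>]])+
  qed
  from bchoice[OF this] obtain B where
    B: "\<forall>\<phi>\<in>?I. bij (\<lambda>x. x + \<phi> x) \<and> (\<forall>y. (\<Psi> \<phi> has_derivative blinfun_apply (B \<phi> y)) (at y)) \<and>
      (\<forall>y. B \<phi> y o\<^sub>L dPhi \<phi> (\<Psi> \<phi> y) = id_blinfun) \<and> (\<forall>y. dPhi \<phi> (\<Psi> \<phi> y) o\<^sub>L B \<phi> y = id_blinfun) \<and>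
      (\<forall>y. norm (B \<phi> y) \<le> 1 / m)" ..
  have bij: "bij (\<lambda>x. x + \<phi> x)"
    and deriv: "(\<Psi> \<phi> has_derivative blinfun_apply (B \<phi> y)) (at y)"
    and BA: "B \<phi> y o\<^sub>L dPhi \<phi> (\<Psi> \<phi> y) = id_blinfun"
    and AB: "dPhi \<phi> (\<Psi> \<phi> y) o\<^sub>L B \<phi> y = id_blinfun"
    and Bbound: "norm (B \<phi> y) \<le> 1 / m" if "\<phi> \<in> ?I" for \<phi> y
    using B that by auto
  show "\<exists>B. (inv (\<lambda>x. x + \<phi> x) has_derivative blinfun_apply B) (at y) \<and>
          dPhi \<phi> (inv (\<lambda>x. x + \<phi> x) y) o\<^sub>L B = id_blinfun" if "\<phi> \<in> ?I" for \<phi> y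
    using deriv[OF that, of y] AB[OF that, of y] unfolding \<Psi>_def by blast
  have right: "\<Psi> \<phi> y + \<phi> (\<Psi> \<phi> y) = y" if "\<phi> \<in> ?I" for \<phi> y
    using surj_f_inv_f[OF bij_is_surj[OF bij[OF that]], of y] by (simp add: \<Psi>_def)
  have left: "\<Psi> \<phi> (x + \<phi> x) = x" if "\<phi> \<in> ?I" for \<phi> x
    using inv_f_f[OF bij_is_inj[OF bij[OF that]], of x] by (simp add: \<Psi>_def)
  have lip: "norm (\<Psi> \<phi> x - \<Psi> \<phi> y) \<le> 1 / m * norm (x - y)" if \<phi>: "\<phi> \<in> ?I" for \<phi> x y
    by (rule differentiable_bound[OF convex_UNIV deriv[OF \<phi>] _ UNIV_I UNIV_I])
      (use Bbound[OF \<phi>] in \<open>simp add: norm_blinfun.rep_eq\<close>)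
  have diff: "norm (\<Psi> \<phi>\<^sub>1 y - \<Psi> \<phi>\<^sub>2 y) powr \<beta> \<le> (1 / m) powr \<beta> * \<sigma> \<phi>\<^sub>1 \<phi>\<^sub>2"
    if \<phi>: "\<phi>\<^sub>1 \<in> ?I" "\<phi>\<^sub>2 \<in> ?I" for \<phi>\<^sub>1 \<phi>\<^sub>2 y
  proof -
    \<comment> \<open>For this \<open>x\<close> one has \<open>y = x + \<phi>\<^sub>2 x\<close> and
      \<open>x = \<Psi> \<phi>\<^sub>1 (x + \<phi>\<^sub>1 x)\<close>, so the Lipschitz bound of
      \<open>\<Psi> \<phi>\<^sub>1\<close> alone compares both inverses at \<open>y\<close>.\<close>
    define x where "x = \<Psi> \<phi>\<^sub>2 y"
    have y: "y = x + \<phi>\<^sub>2 x" using right[OF \<phi>(2)] by (simp add: x_def)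
    have "norm (\<Psi> \<phi>\<^sub>1 y - \<Psi> \<phi>\<^sub>2 y) = norm (\<Psi> \<phi>\<^sub>1 (x + \<phi>\<^sub>2 x) - \<Psi> \<phi>\<^sub>1 (x + \<phi>\<^sub>1 x))"
      using left[OF \<phi>(1)] by (simp add: y[symmetric] flip: x_def)
    also have "\<dots> \<le> 1 / m * norm ((x + \<phi>\<^sub>2 x) - (x + \<phi>\<^sub>1 x))"
      by (rule lip[OF \<phi>(1)])
    also have "norm ((x + \<phi>\<^sub>2 x) - (x + \<phi>\<^sub>1 x)) = norm (\<phi>\<^sub>1 x - \<phi>\<^sub>2 x)"
      by (simp add: norm_minus_commute)
    also have "1 / m * norm (\<phi>\<^sub>1 x - \<phi>\<^sub>2 x) \<le> 1 / m * holder_norm n \<alpha> (\<lambda>x. \<phi>\<^sub>1 x - \<phi>\<^sub>2 x)"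
      using norm_nderiv_le_holder_norm[OF C0_diff[OF C0[OF \<phi>(1)] C0[OF \<phi>(2)]], of "[]" x \<alpha>] m
      by (intro mult_left_mono) auto
    finally have "norm (\<Psi> \<phi>\<^sub>1 y - \<Psi> \<phi>\<^sub>2 y) powr \<beta> \<le> (1 / m * holder_norm n \<alpha> (\<lambda>x. \<phi>\<^sub>1 x - \<phi>\<^sub>2 x)) powr \<beta>"
      using \<beta> by (intro powr_mono2) auto
    then show ?thesis
      using m holder_norm_nonneg[OF C0_diff[OF C0[OF \<phi>(1)] C0[OF \<phi>(2)]], of \<alpha>]
      by (simp add: powr_mult \<sigma>_def ball_sigma_def powr_divide)
  qed
  have lim: "filterlim (\<Psi> \<phi>) at_infinity at_infinity" if \<phi>: "\<phi> \<in> ?I" for \<phi>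
  proof (rule filterlim_norm_at_top_imp_at_infinity)
    have le: "norm y - holder_norm n \<beta> \<phi> \<le> norm (\<Psi> \<phi> y)" for y
      using norm_triangle_ineq[of "\<Psi> \<phi> y" "\<phi> (\<Psi> \<phi> y)"] right[OF \<phi>, of y]
        norm_le_holder_norm[OF n C0[OF \<phi>], of "\<Psi> \<phi> y" \<beta>] by simp
    have "filterlim (\<lambda>y::'a. norm y - holder_norm n \<beta> \<phi>) at_top at_infinity"
      using filterlim_tendsto_add_at_top[OF tendsto_const filterlim_norm_at_top, of "- holder_norm n \<beta> \<phi>"]
      by simp
    then show "filterlim (\<lambda>y. norm (\<Psi> \<phi> y)) at_top at_infinity"
      by (rule filterlim_at_top_mono) (simp add: le)
  qed
  have A_lim: "((\<lambda>y. dPhi \<phi> (\<Psi> \<phi> y)) \<longlongrightarrow> id_blinfun) at_infinity" if \<phi>: "\<phi> \<in> ?I" for \<phi>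
    by (rule filterlim_compose[OF tendsto_dPhi[OF n C0[OF \<phi>]] lim[OF \<phi>]])
  have B_lim: "(B \<phi> \<longlongrightarrow> id_blinfun) at_infinity" if \<phi>: "\<phi> \<in> ?I" for \<phi>
  proof -
    have "((\<lambda>y. B \<phi> y - id_blinfun) \<longlongrightarrow> 0) at_infinity"
    proof (rule Lim_null_comparison)
      show "((\<lambda>y. 1 / m * norm (id_blinfun - dPhi \<phi> (\<Psi> \<phi> y))) \<longlongrightarrow> 0) at_infinity"
        using tendsto_diff[OF tendsto_const A_lim[OF \<phi>], of id_blinfun]
        by (intro tendsto_mult_right_zero tendsto_norm_zero) simp
      have "norm (B \<phi> y - id_blinfun) \<le> 1 / m * norm (id_blinfun - dPhi \<phi> (\<Psi> \<phi> y))" for y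
      proof -
        have "B \<phi> y - id_blinfun = B \<phi> y o\<^sub>L (id_blinfun - dPhi \<phi> (\<Psi> \<phi> y))"
          using BA[OF \<phi>, of y]
          by (simp add: bounded_bilinear.diff_right[OF bounded_bilinear_blinfun_compose])
        also have "norm \<dots> \<le> norm (B \<phi> y) * norm (id_blinfun - dPhi \<phi> (\<Psi> \<phi> y))"
          by (rule norm_blinfun_compose)
        also have "\<dots> \<le> 1 / m * norm (id_blinfun - dPhi \<phi> (\<Psi> \<phi> y))"
          by (rule mult_right_mono[OF Bbound[OF \<phi>] norm_ge_zero])
        finally show ?thesis .
      qed
      then show "\<forall>\<^sub>F y in at_infinity. norm (B \<phi> y - id_blinfun) \<le> 1 / m * norm (id_blinfun - dPhi \<phi> (\<Psi> \<phi> y))"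
        by simp
    qed
    then show ?thesis by (rule LIM_zero_cancel)
  qed
  have \<beta>0: "0 \<le> \<beta>" using \<beta> by simp
  have holder_family_A: "holder_family ?I \<beta> \<sigma> (n - 1) dPhi"
    unfolding \<sigma>_def by (rule holder_family_dPhi[OF \<beta> n \<phi>\<^sub>0])
  \<comment> \<open>The bootstrap: composing \<open>dPhi\<close> with \<open>\<Psi>\<close> at order
    k uses \<open>B\<close> below k, and operator inversion returns \<open>B\<close> at order k. It
    stops at n - 1, the order of \<open>dPhi\<close>.\<close>
  have holder_family_B: "holder_family ?I \<beta> \<sigma> k B" if "k \<le> n - 1" for k
    using that
  proof (induction k rule: less_induct)
    case (less k)
    have h: "holder_family ?I \<beta> \<sigma> k (\<lambda>\<phi> y. dPhi \<phi> (\<Psi> \<phi> y))"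
      by (rule holder_family_compose[where \<Psi> = \<Psi> and B = B, OF \<sigma> \<beta>0 lip diff lim deriv less.IH holder_family_mono[OF holder_family_A]])
        (use less.prems in auto)
    show ?case
      by (rule holder_family_inverse[where K = "1 / m", OF \<sigma> _ _ _ _ h]) (simp_all add: BA AB Bbound B_lim)
  qed
  have inv_c_eq: "inv_c \<phi> = (\<lambda>y. \<Psi> \<phi> y - y)" for \<phi>
    by (simp add: inv_c_def \<Psi>_def)
  \<comment> \<open>Of the two formulas for the inverse, this one gives boundedness and decay, while
    \<open>\<Psi> \<phi> y - y\<close> gives the derivative.\<close>
  have inv_c_eq': "inv_c \<phi> = (\<lambda>y. - \<phi> (\<Psi> \<phi> y))" if "\<phi> \<in> ?I" for \<phi>
  proof
    show "inv_c \<phi> y = - \<phi> (\<Psi> \<phi> y)" for y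
      using right[OF that, of y] by (simp add: inv_c_eq algebra_simps eq_neg_iff_add_eq_0)
  qed
  show "(inv_c \<phi> \<longlongrightarrow> 0) at_infinity" if \<phi>: "\<phi> \<in> ?I" for \<phi>
  proof -
    have "(\<phi> \<longlongrightarrow> 0) at_infinity"
      using C0_tendsto[OF C0[OF \<phi>], of "[]"] by simp
    from tendsto_minus[OF filterlim_compose[OF this lim[OF \<phi>]]] show ?thesis
      by (simp add: inv_c_eq'[OF \<phi>])
  qed
  have "holder_family0 ?I \<beta> \<sigma> (\<lambda>\<phi> x. \<phi> x)"
    using holder_family0_C0_ball[OF \<beta> \<phi>\<^sub>0, of "[]"] by (simp add: \<sigma>_def)
  from holder_family0_linear[OF \<sigma> bounded_linear_minus[OF bounded_linear_ident] holder_family0_compose[where \<Psi> = \<Psi>, OF \<sigma> \<beta>0 lip diff lim this]]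
  have base: "holder_family0 ?I \<beta> \<sigma> inv_c"
    by (rule holder_family0_cong) (simp_all add: inv_c_eq')
  \<comment> \<open>The partial derivatives \<open>B \<phi> y b - b\<close> have order n - 1, so the
    family of inverses gains one order and reaches \<open>n\<close>.\<close>
  have "holder_family ?I \<beta> \<sigma> (Suc (n - 1)) inv_c"
  proof (rule holder_family_SucI[where G = "\<lambda>b \<phi> y. B \<phi> y b - b", OF base])
    fix \<phi> assume \<phi>: "\<phi> \<in> ?I"
    show "(inv_c \<phi> has_derivative (\<lambda>v. \<Sum>b\<in>Basis. (v \<bullet> b) *\<^sub>R (B \<phi> y b - b))) (at y)" for y
    proof -
      have "bounded_linear (\<lambda>v. B \<phi> y v - v)"
        by (intro bounded_linear_sub blinfun.bounded_linear_right bounded_linear_ident)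
      from bounded_linear_componentwise[OF this]
      have "(\<lambda>v. B \<phi> y v - v) = (\<lambda>v. \<Sum>b\<in>Basis. (v \<bullet> b) *\<^sub>R (B \<phi> y b - b))" by blast
      then show ?thesis
        using has_derivative_diff[OF deriv[OF \<phi>, of y] has_derivative_ident] by (simp add: inv_c_eq)
    qed
    show "((\<lambda>y. B \<phi> y b - b) \<longlongrightarrow> 0) at_infinity" for b
      using tendsto_diff[OF blinfun.tendsto[OF B_lim[OF \<phi>] tendsto_const] tendsto_const, of b b] by simp
  next
    show "holder_family ?I \<beta> \<sigma> (n - 1) (\<lambda>\<phi> y. B \<phi> y b - b)" for b
      using holder_family_add[OF \<sigma> holder_family_linear[OF \<sigma> blinfun.bounded_linear_left holder_family_B[OF order_refl]] holder_family_const[OF \<sigma>], of b "- b"]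
      by simp
  qed
  then show "holder_family ?I \<beta> \<sigma> n inv_c"
    using n by simp
qed

text \<open>The estimate interpolates two bounds for differences of inverses: the modulus r^\<beta>
  in the index and the uniform \<beta>-Hoelder bound in the point. That the inverses stay in the
  \<beta>-space is recorded alongside, since the range of \<open>inv_c\<close> is read off from
  it.\<close>

lemma inv_c_locally_holder:
  fixes \<phi>\<^sub>0 :: "real ^ 'd \<Rightarrow> real ^ 'd"
  assumes n: "1 \<le> n" and \<alpha>: "0 < \<alpha>" "\<alpha> < \<beta>" and \<beta>: "\<beta> \<le> 1" and \<phi>\<^sub>0: "\<phi>\<^sub>0 \<in> Diffeos_minus_Id n \<beta>"
  obtains \<delta> M where "\<delta> > 0" "C0_ball n \<beta> \<phi>\<^sub>0 \<delta> \<subseteq> Diffeos_minus_Id n \<beta>"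
    "\<And>\<phi>. \<phi> \<in> C0_ball n \<beta> \<phi>\<^sub>0 \<delta> \<Longrightarrow> inv_c \<phi> \<in> Diffeos_minus_Id n \<beta>"
    "\<And>\<phi>\<^sub>1 \<phi>\<^sub>2. \<phi>\<^sub>1 \<in> C0_ball n \<beta> \<phi>\<^sub>0 \<delta> \<Longrightarrow> \<phi>\<^sub>2 \<in> C0_ball n \<beta> \<phi>\<^sub>0 \<delta> \<Longrightarrow>
       holder_norm n \<alpha> (\<lambda>x. inv_c \<phi>\<^sub>1 x - inv_c \<phi>\<^sub>2 x) \<le> M * holder_norm n \<alpha> (\<lambda>x. \<phi>\<^sub>1 x - \<phi>\<^sub>2 x) powr (\<beta> - \<alpha>)"
proof -
  have \<beta>0: "0 < \<beta>" using \<alpha> by simp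
  have \<phi>\<^sub>0': "\<phi>\<^sub>0 \<in> C0 n \<beta>" and det0: "\<And>x. det (matrix (blinfun_apply (dPhi \<phi>\<^sub>0 x))) > 0"
    using \<phi>\<^sub>0 unfolding Diffeos_minus_Id_iff[OF n] by auto
  have "inj (blinfun_apply (dPhi \<phi>\<^sub>0 x))" for x
    using det0[of x] det_nz_iff_inj[OF linear_blinfun] by (metis less_irrefl)
  from uniform_lower_bound[OF continuous_on_dPhi[OF n \<phi>\<^sub>0'] this tendsto_dPhi[OF n \<phi>\<^sub>0']]
  obtain m where m: "m > 0" "\<And>x v. m * norm v \<le> norm (dPhi \<phi>\<^sub>0 x v)" by blast
  \<comment> \<open>Differentials over the ball differ from that of \<open>\<phi>\<^sub>0\<close> by
    at most \<open>\<delta>\<close>, so half of \<open>m\<close> preserves the sign of the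
    determinant and leaves the lower bound \<open>m / 2\<close>.\<close>
  define \<delta> where "\<delta> = m / 2"
  define \<sigma> :: "(real ^ 'd \<Rightarrow> real ^ 'd) \<Rightarrow> _" where "\<sigma> = ball_sigma n \<alpha> \<beta>"
  let ?I = "C0_ball n \<beta> \<phi>\<^sub>0 \<delta>"
  have \<sigma>: "0 \<le> \<sigma> i j" for i j
    by (simp add: \<sigma>_def ball_sigma_def)
  have \<delta>: "\<delta> > 0" "\<delta> < m" using m by (auto simp: \<delta>_def)
  have C0: "\<phi> \<in> C0 n \<beta>" if "\<phi> \<in> ?I" for \<phi>
    using that by (simp add: C0_ball_def)
  have close: "norm (dPhi \<phi> x - dPhi \<phi>\<^sub>0 x) \<le> \<delta>" if "\<phi> \<in> ?I" for \<phi> x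
    by (rule norm_dPhi_diff_le[OF n \<phi>\<^sub>0' that])
  have det: "det (matrix (blinfun_apply (dPhi \<phi> x))) > 0" if "\<phi> \<in> ?I" for \<phi> x
    by (rule det_pos_perturb[OF det0 m(2) le_less_trans[OF close[OF that] \<delta>(2)]])
  have lower: "m / 2 * norm v \<le> norm (dPhi \<phi> x v)" if "\<phi> \<in> ?I" for \<phi> x v
  proof -
    have "norm ((dPhi \<phi> x - dPhi \<phi>\<^sub>0 x) v) \<le> \<delta> * norm v"
      by (rule order_trans[OF norm_blinfun mult_right_mono[OF close[OF that] norm_ge_zero]])
    then show ?thesis
      using m(2)[of v x] norm_triangle_ineq4[of "dPhi \<phi> x v" "dPhi \<phi> x v - dPhi \<phi>\<^sub>0 x v"]
      by (simp add: blinfun.diff_left \<delta>_def)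
  qed
  have m2: "m / 2 > 0" using m by simp
  have holder_family: "holder_family ?I \<beta> \<sigma> n inv_c"
    unfolding \<sigma>_def by (rule holder_family_inv_c(1)[OF \<beta>0 \<beta> n \<phi>\<^sub>0' m2 lower])
  have lim: "(inv_c \<phi> \<longlongrightarrow> 0) at_infinity" if "\<phi> \<in> ?I" for \<phi>
    by (rule holder_family_inv_c(2)[OF \<beta>0 \<beta> n \<phi>\<^sub>0' m2 lower that])
  have deriv: "\<exists>B. (inv (\<lambda>x. x + \<phi> x) has_derivative blinfun_apply B) (at y) \<and>
      dPhi \<phi> (inv (\<lambda>x. x + \<phi> x) y) o\<^sub>L B = id_blinfun" if "\<phi> \<in> ?I" for \<phi> y
    by (rule holder_family_inv_c(3)[OF \<beta>0 \<beta> n \<phi>\<^sub>0' m2 lower that])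
  have inv_C0: "inv_c \<phi> \<in> C0 n \<beta>" if "\<phi> \<in> ?I" for \<phi>
    by (rule holder_family_imp_C0[OF holder_family lim \<sigma> \<beta>0 that])
  show ?thesis
  proof (rule holder_family_nderiv_bounds[OF holder_family lim \<sigma>])
    fix C :: real assume C: "C \<ge> 0"
      "\<And>i x vs. i \<in> ?I \<Longrightarrow> length vs \<le> n \<Longrightarrow> unit_list vs \<Longrightarrow> norm (nderiv (inv_c i) x vs) \<le> C"
      "\<And>i x y vs. i \<in> ?I \<Longrightarrow> length vs \<le> n \<Longrightarrow> unit_list vs \<Longrightarrow>
         norm (nderiv (inv_c i) x vs - nderiv (inv_c i) y vs) \<le> C * norm (x - y) powr \<beta>"
      "\<And>i j x vs. i \<in> ?I \<Longrightarrow> j \<in> ?I \<Longrightarrow> length vs \<le> n \<Longrightarrow> unit_list vs \<Longrightarrow>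
         norm (nderiv (inv_c i) x vs - nderiv (inv_c j) x vs) \<le> C * \<sigma> i j"
    show ?thesis
    proof (rule that[of \<delta> "2 * C"])
      show "?I \<subseteq> Diffeos_minus_Id n \<beta>"
      proof
        show "\<phi> \<in> Diffeos_minus_Id n \<beta>" if "\<phi> \<in> ?I" for \<phi>
          unfolding Diffeos_minus_Id_iff[OF n] using C0[OF that] det[OF that] by blast
      qed
    next
      fix \<phi> assume \<phi>: "\<phi> \<in> ?I"
      define \<Psi> where "\<Psi> = inv (\<lambda>x. x + \<phi> x)"
      have "det (matrix (frechet_derivative \<Psi> (at y))) > 0" for y
      proof -
        obtain B where B: "(\<Psi> has_derivative blinfun_apply B) (at y)" "dPhi \<phi> (\<Psi> y) o\<^sub>L B = id_blinfun"
          using deriv[OF \<phi>, of y] by (auto simp: \<Psi>_def)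
        \<comment> \<open>The differential of the inverse map inverts \<open>dPhi \<phi>\<close> at
          the preimage, so the two determinants have product 1 and equal sign.\<close>
        have "matrix (blinfun_apply (dPhi \<phi> (\<Psi> y))) ** matrix (blinfun_apply B) = mat 1"
          unfolding matrix_compose[OF linear_blinfun linear_blinfun, symmetric]
          using B(2) by (metis blinfun_apply_id_blinfun blinfun_compose.rep_eq eq_id_iff matrix_id_mat_1)
        then have "det (matrix (blinfun_apply (dPhi \<phi> (\<Psi> y)))) * det (matrix (blinfun_apply B)) = 1"
          by (metis det_I det_mul)
        then have "det (matrix (blinfun_apply B)) > 0"
          using det[OF \<phi>, of "\<Psi> y"] by (metis zero_less_mult_pos zero_less_one)
        then show ?thesis
          using frechet_derivative_at[OF B(1)] by simp
      qed
      moreover have "\<Psi> = (\<lambda>x. x + inv_c \<phi> x)"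
        by (simp add: inv_c_def \<Psi>_def)
      ultimately have "\<Psi> \<in> Diffeos n \<beta>"
        unfolding Diffeos_def using inv_C0[OF \<phi>] by blast
      then show "inv_c \<phi> \<in> Diffeos_minus_Id n \<beta>"
        unfolding Diffeos_minus_Id_def by (rule image_eqI[rotated]) (simp add: inv_c_def \<Psi>_def)
    next
      fix \<phi>\<^sub>1 \<phi>\<^sub>2 assume \<phi>: "\<phi>\<^sub>1 \<in> ?I" "\<phi>\<^sub>2 \<in> ?I"
      define r where "r = holder_norm n \<alpha> (\<lambda>x. \<phi>\<^sub>1 x - \<phi>\<^sub>2 x)"
      have r: "r \<ge> 0" "\<sigma> \<phi>\<^sub>1 \<phi>\<^sub>2 = r powr \<beta>"
        using holder_norm_nonneg[OF C0_diff[OF C0[OF \<phi>(1)] C0[OF \<phi>(2)]]]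
        by (auto simp: r_def \<sigma>_def ball_sigma_def)
      note eq = nderiv_diff[OF C0_basis_differentiable[OF inv_C0[OF \<phi>(1)]] C0_basis_differentiable[OF inv_C0[OF \<phi>(2)]]]
      have "holder_norm n \<alpha> (\<lambda>x. inv_c \<phi>\<^sub>1 x - inv_c \<phi>\<^sub>2 x) \<le> 2 * C * r powr (\<beta> - \<alpha>)"
      proof (rule holder_norm_leI(3))
        fix x :: "real ^ 'd" and vs :: "(real ^ 'd) list"
        assume vs: "length vs \<le> n" "unit_list vs"
        let ?d = "norm (nderiv (inv_c \<phi>\<^sub>1) x vs - nderiv (inv_c \<phi>\<^sub>2) x vs)"
        \<comment> \<open>The supremum part is interpolated with \<open>t = 1\<close>: the plain
          bound 2C takes the place of a Hoelder bound, and the exponent \<beta> - \<alpha> results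
          here too.\<close>
        have "?d \<le> C + C"
          by (rule order_trans[OF norm_triangle_ineq4 add_mono[OF C(2)[OF \<phi>(1) vs] C(2)[OF \<phi>(2) vs]]])
        moreover have "?d \<le> 2 * C * r powr \<beta>"
          by (rule order_trans[OF C(4)[OF \<phi> vs, unfolded r(2)] mult_right_mono]) (use C(1) in auto)
        ultimately have "?d \<le> 2 * C * 1 powr \<alpha> * r powr (\<beta> - \<alpha>)"
          using C(1) r(1) by (intro powr_interpolate \<alpha>) auto
        then show "norm (nderiv (\<lambda>x. inv_c \<phi>\<^sub>1 x - inv_c \<phi>\<^sub>2 x) x vs) \<le> 2 * C * r powr (\<beta> - \<alpha>)"
          by (simp add: eq[OF vs(1)])
      next
        fix x y :: "real ^ 'd" and vs :: "(real ^ 'd) list"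
        assume "length vs = n" "unit_list vs"
        then have vs: "length vs \<le> n" "unit_list vs" by auto
        let ?a = "nderiv (inv_c \<phi>\<^sub>1)" and ?b = "nderiv (inv_c \<phi>\<^sub>2)"
        let ?d = "norm ((?a x vs - ?b x vs) - (?a y vs - ?b y vs))"
        \<comment> \<open>The second difference is grouped in two ways: comparing indices at each
          point gives r^\<beta>, comparing points for each index gives |x - y|^\<beta>.
          Interpolation then yields |x - y|^\<alpha> r^(\<beta>-\<alpha>).\<close>
        have "?d \<le> C * r powr \<beta> + C * r powr \<beta>"
          using C(4)[OF \<phi> vs] unfolding r(2) by (intro order_trans[OF norm_triangle_ineq4 add_mono])
        moreover have "(?a x vs - ?b x vs) - (?a y vs - ?b y vs) = (?a x vs - ?a y vs) - (?b x vs - ?b y vs)"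
          by simp
        then have "?d \<le> C * norm (x - y) powr \<beta> + C * norm (x - y) powr \<beta>"
          using order_trans[OF norm_triangle_ineq4 add_mono[OF C(3)[OF \<phi>(1) vs] C(3)[OF \<phi>(2) vs]]] by metis
        ultimately have "?d \<le> 2 * C * norm (x - y) powr \<alpha> * r powr (\<beta> - \<alpha>)"
          using C(1) r(1) by (intro powr_interpolate \<alpha>) auto
        then show "norm (nderiv (\<lambda>x. inv_c \<phi>\<^sub>1 x - inv_c \<phi>\<^sub>2 x) x vs - nderiv (\<lambda>x. inv_c \<phi>\<^sub>1 x - inv_c \<phi>\<^sub>2 x) y vs)
            \<le> 2 * C * r powr (\<beta> - \<alpha>) * norm (x - y) powr \<alpha>"
          by (simp add: eq[OF vs(1)] mult_ac)
      qed
      then show "holder_norm n \<alpha> (\<lambda>x. inv_c \<phi>\<^sub>1 x - inv_c \<phi>\<^sub>2 x)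
          \<le> 2 * C * holder_norm n \<alpha> (\<lambda>x. \<phi>\<^sub>1 x - \<phi>\<^sub>2 x) powr (\<beta> - \<alpha>)"
        unfolding r_def .
    qed (rule \<delta>(1))
  qed assumption+
qed

section \<open>Range and continuity of the inversion map\<close>

lemma center_in_C0_ball:
  assumes "\<phi> \<in> C0 n \<beta>" "\<delta> > 0"
  shows "(\<phi> :: 'a::euclidean_space \<Rightarrow> 'b::real_normed_vector) \<in> C0_ball n \<beta> \<phi> \<delta>"
  using assms holder_norm_0[of n \<beta>, where ?'a = 'a and ?'b = 'b] by (simp add: C0_ball_def)

theorem proposition3p7:
  fixes n :: nat and \<alpha> \<beta> :: real
  assumes "n \<ge> 1" and "0 < \<alpha>" and "\<alpha> < \<beta>" and "\<beta> \<le> 1"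
  shows "(\<forall>\<phi>\<^sub>0 \<in> (Diffeos_minus_Id n \<beta> :: (real ^ 'd \<Rightarrow> real ^ 'd) set). \<exists>\<delta>>0.
            C0_ball n \<beta> \<phi>\<^sub>0 \<delta> \<subseteq> Diffeos_minus_Id n \<beta> \<and>
            (\<exists>M. \<forall>\<phi>\<^sub>1 \<in> C0_ball n \<beta> \<phi>\<^sub>0 \<delta>. \<forall>\<phi>\<^sub>2 \<in> C0_ball n \<beta> \<phi>\<^sub>0 \<delta>.
               holder_norm n \<alpha> (\<lambda>x. inv_c \<phi>\<^sub>1 x - inv_c \<phi>\<^sub>2 x)
                 \<le> M * holder_norm n \<alpha> (\<lambda>x. \<phi>\<^sub>1 x - \<phi>\<^sub>2 x) powr (\<beta> - \<alpha>)))
       \<and> inv_c ` (Diffeos_minus_Id n \<beta> :: (real ^ 'd \<Rightarrow> real ^ 'd) set) \<subseteq> Diffeos_minus_Id n \<alpha>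
       \<and> continuous_wrt (holder_norm n \<beta>) (holder_norm n \<alpha>)
            (Diffeos_minus_Id n \<beta> :: (real ^ 'd \<Rightarrow> real ^ 'd) set) inv_c"
proof (intro conjI ballI)
  fix \<phi>\<^sub>0 :: "real ^ 'd \<Rightarrow> real ^ 'd" assume "\<phi>\<^sub>0 \<in> Diffeos_minus_Id n \<beta>"
  then show "\<exists>\<delta>>0. C0_ball n \<beta> \<phi>\<^sub>0 \<delta> \<subseteq> Diffeos_minus_Id n \<beta> \<and>
            (\<exists>M. \<forall>\<phi>\<^sub>1 \<in> C0_ball n \<beta> \<phi>\<^sub>0 \<delta>. \<forall>\<phi>\<^sub>2 \<in> C0_ball n \<beta> \<phi>\<^sub>0 \<delta>.
               holder_norm n \<alpha> (\<lambda>x. inv_c \<phi>\<^sub>1 x - inv_c \<phi>\<^sub>2 x)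
                 \<le> M * holder_norm n \<alpha> (\<lambda>x. \<phi>\<^sub>1 x - \<phi>\<^sub>2 x) powr (\<beta> - \<alpha>))"
    by (rule inv_c_locally_holder[OF assms]) blast
next
  show "inv_c ` (Diffeos_minus_Id n \<beta> :: (real ^ 'd \<Rightarrow> real ^ 'd) set) \<subseteq> Diffeos_minus_Id n \<alpha>"
  proof (rule image_subsetI)
    fix \<phi> :: "real ^ 'd \<Rightarrow> real ^ 'd" assume \<phi>: "\<phi> \<in> Diffeos_minus_Id n \<beta>"
    then have C0: "\<phi> \<in> C0 n \<beta>" by (simp add: Diffeos_minus_Id_iff[OF assms(1)])
    \<comment> \<open>The local result is applied on a ball around \<phi> itself, in the
      \<beta>-space; lowering the exponent comes afterwards.\<close>
    have "inv_c \<phi> \<in> Diffeos_minus_Id n \<beta>"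
      by (rule inv_c_locally_holder[OF assms \<phi>]) (use center_in_C0_ball[OF C0] in blast)
    then show "inv_c \<phi> \<in> Diffeos_minus_Id n \<alpha>"
      using C0_mono assms by (auto simp: Diffeos_minus_Id_iff[OF assms(1)])
  qed
next
  show "continuous_wrt (holder_norm n \<beta>) (holder_norm n \<alpha>)
      (Diffeos_minus_Id n \<beta> :: (real ^ 'd \<Rightarrow> real ^ 'd) set) inv_c"
    unfolding continuous_wrt_def
  proof (intro ballI allI impI)
    fix f :: "real ^ 'd \<Rightarrow> real ^ 'd" and e :: real
    assume f: "f \<in> Diffeos_minus_Id n \<beta>" and e: "e > 0"
    then have fC0: "f \<in> C0 n \<beta>" by (simp add: Diffeos_minus_Id_iff[OF assms(1)])
    obtain \<delta> M where \<delta>: "\<delta> > 0" and M: "\<And>\<phi>\<^sub>1 \<phi>\<^sub>2. \<phi>\<^sub>1 \<in> C0_ball n \<beta> f \<delta> \<Longrightarrow> \<phi>\<^sub>2 \<in> C0_ball n \<beta> f \<delta> \<Longrightarrow>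
       holder_norm n \<alpha> (\<lambda>x. inv_c \<phi>\<^sub>1 x - inv_c \<phi>\<^sub>2 x) \<le> M * holder_norm n \<alpha> (\<lambda>x. \<phi>\<^sub>1 x - \<phi>\<^sub>2 x) powr (\<beta> - \<alpha>)"
      by (rule inv_c_locally_holder[OF assms f]) blast
    \<comment> \<open>Chosen so that
      \<open>(\<bar>M\<bar> + 1) * t powr (\<beta> - \<alpha>)\<close> equals \<open>e\<close>.
      \<open>M\<close> comes without a sign, hence the absolute value; the added 1 keeps the
      denominator positive and the final inequality strict.\<close>
    define t where "t = (e / (\<bar>M\<bar> + 1)) powr (1 / (\<beta> - \<alpha>))"
    have t: "t > 0" "t powr (\<beta> - \<alpha>) = e / (\<bar>M\<bar> + 1)"
      using e assms by (auto simp: t_def powr_powr)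
    show "\<exists>d>0. \<forall>g\<in>Diffeos_minus_Id n \<beta>. holder_norm n \<beta> (\<lambda>x. g x - f x) < d \<longrightarrow>
        holder_norm n \<alpha> (\<lambda>x. inv_c g x - inv_c f x) < e"
    proof (intro exI conjI ballI impI)
      \<comment> \<open>The bound \<open>\<delta>\<close> keeps \<open>g\<close> in the ball around
        \<open>f\<close>; halving \<open>t\<close> pays for the factor 2 between the \<alpha>-norm
        and the \<beta>-norm.\<close>
      show "min \<delta> (t / 2) > 0" using \<delta> t by simp
      fix g assume "g \<in> Diffeos_minus_Id n \<beta>" and less: "holder_norm n \<beta> (\<lambda>x. g x - f x) < min \<delta> (t / 2)"
      then have gC0: "g \<in> C0 n \<beta>" by (simp add: Diffeos_minus_Id_iff[OF assms(1)])
      let ?r = "holder_norm n \<alpha> (\<lambda>x. g x - f x)"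
      have "?r \<le> 2 * holder_norm n \<beta> (\<lambda>x. g x - f x)"
        by (rule holder_norm_mono[OF C0_diff[OF gC0 fC0] assms(2,3)])
      then have "?r \<le> t" using less by simp
      then have "?r powr (\<beta> - \<alpha>) \<le> e / (\<bar>M\<bar> + 1)"
        using holder_norm_nonneg[OF C0_diff[OF gC0 fC0], of \<alpha>] assms
        unfolding t(2)[symmetric] by (intro powr_mono2) auto
      have "holder_norm n \<alpha> (\<lambda>x. inv_c g x - inv_c f x) \<le> M * ?r powr (\<beta> - \<alpha>)"
        using less gC0 center_in_C0_ball[OF fC0 \<delta>] by (intro M) (auto simp: C0_ball_def)
      also have "\<dots> \<le> \<bar>M\<bar> * ?r powr (\<beta> - \<alpha>)"
        by (intro mult_right_mono) auto
      also have "\<dots> \<le> \<bar>M\<bar> * (e / (\<bar>M\<bar> + 1))"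
        by (intro mult_left_mono) (fact, simp)
      also have "\<dots> < e"
        using e by (simp add: field_simps)
      finally show "holder_norm n \<alpha> (\<lambda>x. inv_c g x - inv_c f x) < e" .
    qed
  qed
qed

end
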